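(* Let $p$ be an odd prime, $t=(p-1)/2$ and $w\ge1$. Let $\rho_w$ be the $p$-bar core with core $t$-tuple $((\ell_1,0),\dots,(\ell_t,0))$, $\ell_i=w+(i-1)(w-1)$. Then $\rho_w^w$ is the block of maximal rank among the blocks of weight $w$ which do not lie at the maximal-rank end of any maximal $i$-string ($i=0,1,\dots,t$) of the block-reduced crystal graph, and its rank is $$N=pw+\Bigl(\frac{p(w-1)}{2}+1\Bigr)\cdot\sum_{i=1}^{t}\bigl(i^2(w-1)+i\bigr).$$
   Context: Let $p$ be an odd prime, $t=(p-1)/2$. A partition is strict if its parts are distinct, and $p$-strict if no part is repeated except possibly parts divisible by $p$. The abacus has runners $0,\dots,p-1$; a part $ap+b$ ($0\le b<p$) is a bead on runner $b$ at height $a$. Removing a $p$-bar means: replacing a part $x>p$ by $x-p$ when the result is an allowed partition; or deleting a part equal to $p$; or deleting two parts whose sum is $p$. Removing as many $p$-bars as possible from $\lambda$ yields its $p$-bar core $\rho(\lambda)$; the number of $p$-bars removed is the weight $w$. A $p$-bar core has no beads on runner $0$, has beads on at most one of the runners $j,p-j$ for each $j$, and all beads are pushed down. Its core $t$-tuple is $((\ell_1,\epsilon_1),\dots,(\ell_t,\epsilon_t))$, where $\ell_j$ is the number of beads on runner $j$ or $p-j$, and $\epsilon_j=0$ if there are beads on runner $j$ and $\epsilon_j=1$ otherwise (so $\epsilon_j=1$ when $\ell_j=0$). The label $\rho^w$ denotes the spin block (of a double cover of the symmetric or alternating group) with core $\rho$ and weight $w$; its rank is $|\rho|+pw$. Block-reduced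 crystal graph. A $p$-restricted partition is a $p$-strict partition with $\lambda_i-\lambda_{i+1}\le p$ for all $i$ (with $\lambda_{r+1}=0$ after the last part $\lambda_r$), and $\lambda_i-\lambda_{i+1}<p$ whenever $p\mid\lambda_i$. Each row of the Young diagram is filled, from left to right, with repetitions of the sequence $0,1,\dots,t-1,t,t-1,\dots,1,0$ of length $p$; the entry of a node is its residue. A node $A\in\lambda$ is $i$-removable if either (1) $\mathrm{res}\,A=i$ and $\lambda\setminus\{A\}$ is $p$-strict, or (2) $i=0$, the node $B$ immediately to the right of $A$ belongs to $\lambda$, $\mathrm{res}\,A=\mathrm{res}\,B=0$, and both $\lambda\setminus\{B\}$ and $\lambda\setminus\{A,B\}$ are $p$-strict. A node $B\notin\lambda$ is $i$-addable if either (1) $\mathrm{res}\,B=i$ and $\lambda\cup\{B\}$ is $p$-strict, or (2) $i=0$, the node $A$ immediately to the left of $B$ does not belong to $\lambda$, $\mathrm{res}\,A=\mathrm{res}\,B=0$, and both $\lambda\cup\{A\}$ and $\lambda\cup\{A,B\}$ are $p$-strict. Write $+$ for each $i$-addable node and $-$ for each $i$-removable node, reading along the rim from bottom left to top right, and successively erase neighbouring pairs $+-$, leaving a sequence of $-$'s followed by $+$'s. The node of the rightmost remaining $-$ is $i$-good, and the node of the leftmost remaining $+$ is $i$-cogood. The crystal graph has the $p$-restricted partitions as vertices, with an edge labeled $i\in\{0,\dots,t\}$ between two of them when one is obtained from the other by removing an $i$-good node (equivalently, the other is obtained by adding an $i$-cogood node). The block-reduced crystal graph has as vertices the labels $\rho^w$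 (all cores $\rho$, all $w\ge0$), with an $i$-edge between two labels whenever there is an $i$-edge between some $p$-restricted partitions having those cores and weights. A maximal $i$-string is a maximal sequence of blocks successively joined by $i$-edges (the rank increasing by $1$ at each step). *)

theory Defs
  imports Complex_Main "HOL-Library.Multiset" "HOL-Computational_Algebra.Primes"
begin

section \<open>Partitions\<close>

definition is_partition :: "nat list \<Rightarrow> bool" where
  "is_partition xs \<longleftrightarrow> sorted_wrt (\<ge>) xs \<and> 0 \<notin> set xs"

definition p_strict :: "nat \<Rightarrow> nat list \<Rightarrow> bool" where
  "p_strict p xs \<longleftrightarrow> is_partition xs \<and> (\<forall>x\<in>set xs. count_list xs x > 1 \<longrightarrow> p dvd x)"

text \<open>Parts are indexed from \<open>0\<close> and the partition is extended by zero parts.\<close>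

definition part :: "nat list \<Rightarrow> nat \<Rightarrow> nat" where
  "part xs r = (if r < length xs then xs ! r else 0)"

definition p_restricted :: "nat \<Rightarrow> nat list \<Rightarrow> bool" where
  "p_restricted p xs \<longleftrightarrow> p_strict p xs \<and>
     (\<forall>r<length xs. part xs r - part xs (Suc r) \<le> p \<and>
                    (p dvd part xs r \<longrightarrow> part xs r - part xs (Suc r) < p))"


section \<open>Bars, cores and weights\<close>

inductive remove_pbar :: "nat \<Rightarrow> nat list \<Rightarrow> nat list \<Rightarrow> bool" for p :: nat where
  slide: "\<lbrakk>p_strict p xs; p_strict p ys; x > p;
           mset xs = add_mset x M; mset ys = add_mset (x - p) M\<rbrakk> \<Longrightarrow> remove_pbar p xs ys"
| delete: "\<lbrakk>p_strict p xs; p_strict p ys;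
            mset xs = add_mset p (mset ys)\<rbrakk> \<Longrightarrow> remove_pbar p xs ys"
| delete_pair: "\<lbrakk>p_strict p xs; p_strict p ys; x + y = p;
            mset xs = add_mset x (add_mset y (mset ys))\<rbrakk> \<Longrightarrow> remove_pbar p xs ys"

definition pbar_core :: "nat \<Rightarrow> nat list \<Rightarrow> bool" where
  "pbar_core p rho \<longleftrightarrow> p_strict p rho \<and> (\<nexists>ys. remove_pbar p rho ys)"

text \<open>A block label \<open>\<rho>\<^sup>w\<close> is the pair \<open>(\<rho>, w)\<close>.\<close>

type_synonym block = "nat list \<times> nat"

definition is_block :: "nat \<Rightarrow> block \<Rightarrow> bool" where
  "is_block p b \<longleftrightarrow> pbar_core p (fst b)"

definition weight :: "block \<Rightarrow> nat" where
  "weight b = snd b"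

definition rank :: "nat \<Rightarrow> block \<Rightarrow> nat" where
  "rank p b = sum_list (fst b) + p * snd b"

definition has_core_weight :: "nat \<Rightarrow> nat list \<Rightarrow> block \<Rightarrow> bool" where
  "has_core_weight p xs b \<longleftrightarrow> pbar_core p (fst b) \<and> (remove_pbar p ^^ snd b) xs (fst b)"

definition core_tuple :: "nat \<Rightarrow> nat list \<Rightarrow> (nat \<times> nat) list" where
  "core_tuple p rho =
     map (\<lambda>j. (length (filter (\<lambda>x. x mod p = j \<or> x mod p = p - j) rho),
               if \<exists>x\<in>set rho. x mod p = j then 0 else 1))
         [1..<Suc ((p - 1) div 2)]"

definition core_of_tuple :: "nat \<Rightarrow> (nat \<times> nat) list \<Rightarrow> nat list" where
  "core_of_tuple p T = (THE rho. pbar_core p rho \<and> core_tuple p rho = T)"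


section \<open>Residues, removable and addable nodes\<close>

text \<open>A node is a pair (row, column), both counted from \<open>0\<close>.\<close>

type_synonym node = "nat \<times> nat"

definition young :: "nat list \<Rightarrow> node set" where
  "young xs = {(r, c). c < part xs r}"

definition p_strict_diagram :: "nat \<Rightarrow> node set \<Rightarrow> bool" where
  "p_strict_diagram p D \<longleftrightarrow> (\<exists>xs. p_strict p xs \<and> D = young xs)"

text \<open>Along a row this is the \<open>p\<close>-periodic sequence \<open>0, 1, \<dots>, t-1, t, t-1, \<dots>, 1, 0\<close>
  where \<open>p = 2t + 1\<close>.\<close>

definition res :: "nat \<Rightarrow> node \<Rightarrow> nat" where
  "res p A = min (snd A mod p) (p - 1 - snd A mod p)"

definition removable :: "nat \<Rightarrow> nat \<Rightarrow> nat list \<Rightarrow> node \<Rightarrow> bool" where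
  "removable p i xs A \<longleftrightarrow> A \<in> young xs \<and>
     ((res p A = i \<and> p_strict_diagram p (young xs - {A})) \<or>
      (i = 0 \<and> (let B = (fst A, Suc (snd A)) in
         B \<in> young xs \<and> res p A = 0 \<and> res p B = 0 \<and>
         p_strict_diagram p (young xs - {B}) \<and> p_strict_diagram p (young xs - {A, B}))))"

definition addable :: "nat \<Rightarrow> nat \<Rightarrow> nat list \<Rightarrow> node \<Rightarrow> bool" where
  "addable p i xs B \<longleftrightarrow> B \<notin> young xs \<and>
     ((res p B = i \<and> p_strict_diagram p (young xs \<union> {B})) \<or>
      (i = 0 \<and> snd B > 0 \<and> (let A = (fst B, snd B - 1) in
         A \<notin> young xs \<and> res p A = 0 \<and> res p B = 0 \<and>
         p_strict_diagram p (young xs \<union> {A}) \<and> p_strict_diagram p (young xs \<union> {A, B}))))"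


section \<open>Signatures and the crystal graph\<close>

datatype sign = Plus | Minus

text \<open>All nodes that can possibly be addable or removable, listed row by row from the bottom row
  (the empty row below the partition) to the top row, and from left to right within a row:
  an addable node lies at most two places beyond the end of its row.\<close>

definition scan_nodes :: "nat list \<Rightarrow> node list" where
  "scan_nodes xs =
     concat (map (\<lambda>r. map (\<lambda>c. (r, c)) [0..<part xs r + 2]) (rev [0..<Suc (length xs)]))"

definition signature :: "nat \<Rightarrow> nat \<Rightarrow> nat list \<Rightarrow> (sign \<times> node) list" where
  "signature p i xs =
     map (\<lambda>A. (if removable p i xs A then Minus else Plus, A))
       (filter (\<lambda>A. removable p i xs A \<or> addable p i xs A) (scan_nodes xs))"

inductive erase_pair :: "(sign \<times> node) list \<Rightarrow> (sign \<times> node) list \<Rightarrow> bool" where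
  "erase_pair (u @ [(Plus, A), (Minus, B)] @ v) (u @ v)"

definition good :: "nat \<Rightarrow> nat \<Rightarrow> nat list \<Rightarrow> node \<Rightarrow> bool" where
  "good p i xs A \<longleftrightarrow>
     (\<exists>u v. erase_pair\<^sup>*\<^sup>* (signature p i xs) (u @ [(Minus, A)] @ v) \<and>
            (\<forall>x\<in>set u. fst x = Minus) \<and> (\<forall>x\<in>set v. fst x = Plus))"

text \<open>Edges are oriented in the direction of increasing rank.\<close>

definition crystal_edge :: "nat \<Rightarrow> nat \<Rightarrow> nat list \<Rightarrow> nat list \<Rightarrow> bool" where
  "crystal_edge p i ys xs \<longleftrightarrow> p_restricted p ys \<and> p_restricted p xs \<and>
     (\<exists>A. good p i xs A \<and> young ys = young xs - {A})"

definition block_edge :: "nat \<Rightarrow> nat \<Rightarrow> block \<Rightarrow> block \<Rightarrow> bool" where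
  "block_edge p i b c \<longleftrightarrow>
     (\<exists>ys xs. crystal_edge p i ys xs \<and> has_core_weight p ys b \<and> has_core_weight p xs c)"


section \<open>Maximal strings\<close>

text \<open>A block without any \<open>i\<close>-edge forms a maximal \<open>i\<close>-string of length one.\<close>

definition maximal_string :: "nat \<Rightarrow> nat \<Rightarrow> block list \<Rightarrow> bool" where
  "maximal_string p i bs \<longleftrightarrow> bs \<noteq> [] \<and> (\<forall>b\<in>set bs. is_block p b) \<and>
     successively (block_edge p i) bs \<and>
     (\<nexists>b. block_edge p i b (hd bs)) \<and> (\<nexists>c. block_edge p i (last bs) c)"

definition at_max_end :: "nat \<Rightarrow> nat \<Rightarrow> block \<Rightarrow> bool" where
  "at_max_end p i b \<longleftrightarrow> (\<exists>bs. maximal_string p i bs \<and> last bs = b)"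

definition non_end_blocks :: "nat \<Rightarrow> nat \<Rightarrow> block set" where
  "non_end_blocks p w =
     {b. is_block p b \<and> weight b = w \<and> \<not> (\<exists>i\<in>{0..(p - 1) div 2}. at_max_end p i b)}"

end

theory Submission
  imports Defs
begin

text \<open>
  Let \<open>n\<^sub>j\<close> be the number of beads on runner \<open>j\<close> minus the number on runner \<open>p - j\<close>. Bar removal
  preserves these charges, they determine the core, and the core of charge \<open>n\<close> has size
  \<open>\<Sum>\<^sub>j (p n\<^sub>j (n\<^sub>j - 1) / 2 + j n\<^sub>j)\<close>. Adding a node of residue \<open>i\<close> moves one bead across, so an
  \<open>i\<close>-edge out of a block of weight \<open>w\<close> leads to weight \<open>w - n\<^sub>1\<close> (\<open>i = 0\<close>),
  \<open>w + n\<^sub>i - n\<^bsub>i+1\<^esub> - 1\<close> (\<open>0 < i < t\<close>) or \<open>w + 2 n\<^sub>t - 2\<close> (\<open>i = t\<close>). Non-negativity of these weights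
  confines the charges of the blocks in question to a simplex, on which the convex size function
  is maximal exactly at the vertex \<open>n\<^sub>j = 1 + j (w - 1)\<close>. Conversely, at this vertex the \<open>i\<close>-edge with
  \<open>i < t\<close> leads to a core of weight \<open>0\<close>, and the \<open>t\<close>-edge starts at the partition obtained
  from the core by adjoining the part \<open>w p\<close>; in each of these cases no sign is ever erased from the
  relevant signature.
\<close>

section \<open>Young diagrams that differ by one node\<close>

section \<open>Adding and removing nodes\<close>

text \<open>In a weakly decreasing list the parts above \<open>c\<close> form an initial
  segment.\<close>

lemma part_less_iff:
  "sorted_wrt (\<ge>) xs \<Longrightarrow> c < part xs r \<longleftrightarrow> r < length (filter ((<) c) xs)"
proof (induction xs arbitrary: r)
  case Nil
  then show ?case by (simp add: part_def)
next
  case (Cons a xs)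
  have tail: "part (a # xs) r = (case r of 0 \<Rightarrow> a | Suc s \<Rightarrow> part xs s)"
    by (simp add: part_def split: nat.split)
  show ?case
  proof (cases "c < a")
    case True
    then show ?thesis using Cons unfolding tail by (auto split: nat.split)
  next
    case False
    then have "filter ((<) c) xs = []"
      using Cons.prems by (auto simp: filter_empty_conv)
    then show ?thesis using Cons False unfolding tail by (auto split: nat.split)
  qed
qed

text \<open>Each row telescopes. Additive statistics of the parts, such as size and charges, thus
  become sums over nodes, and removing a node changes them by a single term.\<close>

lemma sum_young:
  fixes f :: "nat \<Rightarrow> int"
  assumes "f 0 = 0"
  shows "(\<Sum>A\<in>young xs. f (Suc (snd A)) - f (snd A)) = sum_list (map f xs)"
proof -
  have y: "young xs = (SIGMA r:{..<length xs}. {..<xs ! r})"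
    by (auto simp: young_def part_def split: if_splits)
  have "(\<Sum>A\<in>young xs. f (Suc (snd A)) - f (snd A))
      = (\<Sum>r<length xs. \<Sum>c<xs ! r. f (Suc c) - f c)"
    unfolding y by (subst sum.Sigma) (auto simp: case_prod_beta)
  also have "\<dots> = (\<Sum>r<length xs. f (xs ! r))"
    by (simp only: sum_lessThan_telescope) (simp add: assms)
  also have "\<dots> = sum_list (map f xs)"
    by (simp add: sum_list_sum_nth atLeast0LessThan)
  finally show ?thesis .
qed

lemma finite_young: "finite (young xs)"
proof -
  have "young xs = (SIGMA r:{..<length xs}. {..<xs ! r})"
    by (auto simp: young_def part_def split: if_splits)
  then show ?thesis by simp
qed

lemma sum_list_remove_node:
  fixes f :: "nat \<Rightarrow> int"
  assumes "f 0 = 0" "A \<in> young xs" "young ys = young xs - {A}"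
  shows "sum_list (map f xs) = sum_list (map f ys) + (f (Suc (snd A)) - f (snd A))"
proof -
  have "(\<Sum>A\<in>young zs. f (Suc (snd A)) - f (snd A)) = sum_list (map f zs)" for zs
    by (rule sum_young) (rule assms(1))
  then show ?thesis
    using sum.remove[OF finite_young assms(2), of "\<lambda>A. f (Suc (snd A)) - f (snd A)"]
    by (simp flip: assms(3))
qed

lemma removed_node_column:
  assumes "p_strict_diagram p (young xs - {(r, c)})" "(r, c) \<in> young xs"
  shows "part xs r = Suc c"
proof (rule ccontr)
  assume "part xs r \<noteq> Suc c"
  obtain zs where zs: "young xs - {(r, c)} = young zs"
    using assms(1) by (auto simp: p_strict_diagram_def)
  have "(r, Suc c) \<in> young xs - {(r, c)}"
    using assms(2) \<open>part xs r \<noteq> Suc c\<close> by (auto simp: young_def)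
  then have "(r, c) \<in> young zs" unfolding zs by (auto simp: young_def)
  then show False using zs by blast
qed

lemma added_node_column:
  assumes "p_strict_diagram p (young xs \<union> {(r, c)})" "(r, c) \<notin> young xs"
  shows "part xs r = c"
proof (rule ccontr)
  assume "part xs r \<noteq> c"
  with assms(2) have lt: "part xs r < c" by (auto simp: young_def)
  obtain zs where zs: "young xs \<union> {(r, c)} = young zs"
    using assms(1) by (auto simp: p_strict_diagram_def)
  then have "(r, c) \<in> young zs" by blast
  then have "(r, c - 1) \<in> young zs" by (auto simp: young_def)
  then have "(r, c - 1) \<in> young xs \<union> {(r, c)}" using zs by simp
  then show False using lt by (auto simp: young_def)
qed

text \<open>Clause (2) of removability concerns the last but one node of a row, but there the last
  node has residue 0 as well. So the residue can always be read off at the end of the row.\<close>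

lemma removable_residue:
  assumes "removable p i xs (r, c)"
  shows "0 < part xs r \<and> res p (r, part xs r - 1) = i"
proof -
  from assms consider
    "(r, c) \<in> young xs" "res p (r, c) = i" "p_strict_diagram p (young xs - {(r, c)})"
  | "i = 0" "(r, Suc c) \<in> young xs" "res p (r, Suc c) = 0"
    "p_strict_diagram p (young xs - {(r, Suc c)})"
    by (auto simp: removable_def Let_def)
  then show ?thesis
    by cases (use removed_node_column in fastforce)+
qed

text \<open>In clause (2) of addability the first free place of the row has residue 0 too, and
  filling it alone is allowed.\<close>

lemma addable_residue:
  assumes "addable p i xs (r, c)"
  shows "res p (r, part xs r) = i \<and> p_strict_diagram p (young xs \<union> {(r, part xs r)})"
proof -
  from assms consider
    "(r, c) \<notin> young xs" "res p (r, c) = i" "p_strict_diagram p (young xs \<union> {(r, c)})"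
  | "i = 0" "(r, c - 1) \<notin> young xs" "res p (r, c - 1) = 0"
    "p_strict_diagram p (young xs \<union> {(r, c - 1)})"
    by (auto simp: addable_def Let_def)
  then show ?thesis
    by cases (use added_node_column in fastforce)+
qed

text \<open>Lengthening row \<open>r\<close> makes it equal to row \<open>s\<close>, and only
  multiples of \<open>p\<close> may be repeated.\<close>

lemma p_strict_add_node_dvd:
  assumes "p_strict_diagram p (young xs \<union> {(r, part xs r)})"
    and "part xs s = Suc (part xs r)"
  shows "p dvd Suc (part xs r)"
proof -
  let ?v = "Suc (part xs r)"
  obtain zs where zs: "young zs = young xs \<union> {(r, part xs r)}" and st: "p_strict p zs"
    using assms(1) by (auto simp: p_strict_diagram_def)
  have rs: "r \<noteq> s" using assms(2) by auto
  have mem: "c < part zs k \<longleftrightarrow> c < part xs k \<or> k = r \<and> c = part xs r" for k c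
  proof -
    have "(k, c) \<in> young zs \<longleftrightarrow> (k, c) \<in> young xs \<union> {(r, part xs r)}" by (simp add: zs)
    then show ?thesis by (auto simp: young_def)
  qed
  have r: "part zs r = ?v"
    using mem[of "part xs r" r] mem[of ?v r] by (auto simp: not_less intro: antisym)
  have s: "part zs s = ?v"
    using mem[of "part xs r" s] mem[of ?v s] assms(2) rs by (auto simp: not_less intro: antisym)
  have "{r, s} \<subseteq> {k. k < length zs \<and> zs ! k = ?v}"
    using r s by (auto simp: part_def split: if_splits)
  then have "card {r, s} \<le> card {k. k < length zs \<and> zs ! k = ?v}"
    by (intro card_mono) auto
  then have "count_list zs ?v > 1"
    using rs by (simp add: count_list_eq_length_filter length_filter_conv_card eq_commute)
  moreover from this have "?v \<in> set zs"
    by (metis count_notin not_one_less_zero)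
  ultimately show ?thesis using st by (auto simp: p_strict_def)
qed

section \<open>Partitions with distinct parts, described by sets\<close>

section \<open>Strict partitions as sets of parts\<close>

text \<open>The endpoints of the crystal edges constructed below have distinct parts, so they can be
  handled as finite sets.\<close>

definition strict_partition :: "nat set \<Rightarrow> nat list" where
  "strict_partition S = rev (sorted_list_of_set S)"

lemma set_strict_partition [simp]: "finite S \<Longrightarrow> set (strict_partition S) = S"
  by (simp add: strict_partition_def)

lemma distinct_strict_partition [simp]: "distinct (strict_partition S)"
  by (simp add: strict_partition_def)

lemma sorted_strict_partition: "sorted_wrt (\<ge>) (strict_partition S)"
  using sorted_sorted_list_of_set[of S]
  by (simp add: strict_partition_def sorted_wrt_rev)

lemma strict_partition_set:
  assumes "sorted_wrt (\<ge>) xs" "distinct xs"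
  shows "strict_partition (set xs) = xs"
proof -
  have "sorted (rev xs)" using assms(1) by (simp add: sorted_wrt_rev)
  then have "sorted_list_of_set (set (rev xs)) = rev xs"
    using assms(2) by (intro sorted_list_of_set.idem_if_sorted_distinct) auto
  then show ?thesis by (simp add: strict_partition_def)
qed

lemma sum_list_strict_partition: "finite S \<Longrightarrow> sum_list (map f (strict_partition S)) = sum f S"
  by (simp add: sum_list_distinct_conv_sum_set)

lemma p_strict_strict_partition:
  assumes "finite S" "0 \<notin> S"
  shows "p_strict p (strict_partition S)"
proof -
  have "\<not> 1 < count_list (strict_partition S) x" for x
    by (simp flip: count_mset add: distinct_count_atmost_1[THEN iffD1, rule_format])
  then show ?thesis
    using assms sorted_strict_partition[of S] by (auto simp: p_strict_def is_partition_def)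
qed

lemma less_part_strict_partition:
  assumes "finite S"
  shows "c < part (strict_partition S) r \<longleftrightarrow> r < card {y \<in> S. c < y}"
  using part_less_iff[OF sorted_strict_partition, of c S r]
    distinct_length_filter[OF distinct_strict_partition, of "(<) c" S] assms
  by (simp add: Int_def conj_commute)

lemma part_strict_partition:
  assumes "finite S" "x \<in> S"
  shows "part (strict_partition S) (card {y \<in> S. x < y}) = x"
proof (rule antisym)
  show "part (strict_partition S) (card {y \<in> S. x < y}) \<le> x"
    using less_part_strict_partition[OF assms(1), of x] by (simp flip: not_less)
  have "c < part (strict_partition S) (card {y \<in> S. x < y})" if "c < x" for c
    unfolding less_part_strict_partition[OF assms(1)]
    using that assms by (intro psubset_card_mono) auto
  then show "x \<le> part (strict_partition S) (card {y \<in> S. x < y})"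
    by (meson less_irrefl not_le)
qed

lemma part_strict_partition_mem:
  assumes "finite S" "0 < part (strict_partition S) r"
  shows "part (strict_partition S) r \<in> S"
    and "r = card {y \<in> S. part (strict_partition S) r < y}"
proof -
  let ?z = "part (strict_partition S) r"
  let ?k = "card {y \<in> S. ?z < y}"
  have r: "r < length (strict_partition S)" and z: "?z = strict_partition S ! r"
    using assms(2) by (auto simp: part_def split: if_splits)
  then show mem: "?z \<in> S" using assms(1) by (metis nth_mem set_strict_partition)
  have k: "part (strict_partition S) ?k = ?z" by (rule part_strict_partition[OF assms(1) mem])
  then have "?k < length (strict_partition S)" "strict_partition S ! ?k = ?z"
    using assms(2) by (auto simp: part_def split: if_splits)
  then show "r = ?k" using r z by (metis distinct_strict_partition nth_eq_iff_index_eq)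
qed

text \<open>The part following \<open>z\<close> is the largest smaller element, hence at least the
  witness \<open>y\<close>; past the end the parts are 0, which makes \<open>y = 0\<close>
  available.\<close>

lemma p_restricted_strict_partition:
  assumes fin: "finite S" and nz: "0 \<notin> S"
    and gap: "\<And>z. z \<in> S \<Longrightarrow>
      \<exists>y\<in>insert 0 S. y < z \<and> z \<le> y + p \<and> (p dvd z \<longrightarrow> z < y + p)"
  shows "p_restricted p (strict_partition S)"
  unfolding p_restricted_def
proof (intro conjI allI impI)
  show "p_strict p (strict_partition S)" using p_strict_strict_partition[OF fin nz] .
  fix r assume "r < length (strict_partition S)"
  let ?z = "part (strict_partition S) r" and ?n = "part (strict_partition S) (Suc r)"
  have "?z \<in> S"
    using \<open>r < length _\<close> fin by (metis nth_mem part_def set_strict_partition)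
  then have "0 < ?z" using nz by (metis gr0I)
  then have r: "r = card {y \<in> S. ?z < y}" by (rule part_strict_partition_mem[OF fin])
  obtain y where y: "y \<in> insert 0 S" "y < ?z" "?z \<le> y + p" "p dvd ?z \<longrightarrow> ?z < y + p"
    using gap[OF \<open>?z \<in> S\<close>] by blast
  have "y \<le> ?n"
  proof (cases "y = 0")
    case False
    then have "y \<in> S" using y by simp
    \<comment> \<open>The \<open>r\<close> parts above \<open>?z\<close>, together with
      \<open>?z\<close> and \<open>y\<close>, are \<open>r + 2\<close> parts of size at least
      \<open>y\<close>.\<close>
    have "insert ?z (insert y {v \<in> S. ?z < v}) \<subseteq> {v \<in> S. y - 1 < v}"
      using False \<open>y \<in> S\<close> \<open>?z \<in> S\<close> y by auto
    then have "card (insert ?z (insert y {v \<in> S. ?z < v})) \<le> card {v \<in> S. y - 1 < v}"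
      using fin by (intro card_mono) auto
    moreover have "card (insert ?z (insert y {v \<in> S. ?z < v})) = Suc (Suc r)"
      using fin y(2) by (subst (2) r) (simp add: card_insert_if)
    ultimately have "y - 1 < ?n" unfolding less_part_strict_partition[OF fin] by simp
    then show ?thesis by simp
  qed simp
  then show "?z - ?n \<le> p" "p dvd ?z \<Longrightarrow> ?z - ?n < p" using y by auto
qed

text \<open>Removes the last node from the row of the part \<open>x\<close>; taking out
  \<open>{0}\<close> deletes the row when \<open>x = 1\<close>.\<close>

definition lower :: "nat \<Rightarrow> nat set \<Rightarrow> nat set" where
  "lower x S = (S - {x}) \<union> ({x - 1} - {0})"

lemma young_lower:
  assumes fin: "finite S" and "0 \<notin> S" and x: "x \<in> S" "x - 1 \<notin> S"
  shows "young (strict_partition (lower x S)) =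
    young (strict_partition S) - {(card {y \<in> S. x < y}, x - 1)}"
proof -
  have x0: "0 < x" using assms by (metis gr0I)
  have fin': "finite (lower x S)" using fin by (simp add: lower_def)
  have "(r < card {y \<in> lower x S. c < y}) \<longleftrightarrow>
     r < card {y \<in> S. c < y} \<and> (r, c) \<noteq> (card {y \<in> S. x < y}, x - 1)" for r c
  proof -
    \<comment> \<open>Only column \<open>x - 1\<close> loses a node: \<open>x\<close> and
      \<open>x - 1\<close> both exceed \<open>c\<close> if \<open>c < x - 1\<close>, and neither
      does if \<open>x \<le> c\<close>.\<close>
    consider "c = x - 1" | "x \<le> c" | "c < x - 1" by linarith
    then show ?thesis
    proof cases
      case 1
      have "{y \<in> lower x S. c < y} = {y \<in> S. x < y}"
        using 1 x0 by (auto simp: lower_def)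
      moreover have "{y \<in> S. c < y} = insert x {y \<in> S. x < y}"
        using 1 x0 x by auto
      then have "card {y \<in> S. c < y} = Suc (card {y \<in> S. x < y})" using fin by simp
      ultimately show ?thesis using 1 by (simp add: less_Suc_eq) blast
    next
      case 2
      then have "{y \<in> lower x S. c < y} = {y \<in> S. c < y}"
        using x0 by (auto simp: lower_def)
      moreover have "c \<noteq> x - 1" using 2 x0 by simp
      ultimately show ?thesis by simp
    next
      case 3
      have "{y \<in> lower x S. c < y} = insert (x - 1) ({y \<in> S. c < y} - {x})"
        using 3 by (auto simp: lower_def)
      moreover have "card \<dots> = card {y \<in> S. c < y}"
        using 3 x fin card.remove[of "{y \<in> S. c < y}" x] by simp
      moreover have "c \<noteq> x - 1" using 3 by simp
      ultimately show ?thesis by simp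
    qed
  qed
  then show ?thesis
    by (auto simp: young_def less_part_strict_partition fin fin')
qed

section \<open>Good nodes read off from already reduced signatures\<close>

section \<open>Signatures without cancellation\<close>

lemma sorted_wrt_concat_rows:
  assumes "sorted_wrt (>) rs"
  shows "sorted_wrt (\<lambda>A B. fst B < fst A \<or> fst A = fst B \<and> snd A < snd B)
    (concat (map (\<lambda>r. map (\<lambda>c. (r::nat, c::nat)) [0..<f r]) rs))"
  using assms
proof (induction rs)
  case (Cons r rs)
  have "sorted_wrt (<) [0..<f r]" by simp
  then have "sorted_wrt (\<lambda>A B. fst B < fst A \<or> fst A = fst B \<and> snd A < snd B)
      (map (\<lambda>c. (r, c)) [0..<f r])"
    by (simp add: sorted_wrt_map)
  then show ?case using Cons by (auto simp: sorted_wrt_append)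
qed simp

lemma sorted_scan_nodes:
  "sorted_wrt (\<lambda>A B. fst B < fst A \<or> fst A = fst B \<and> snd A < snd B) (scan_nodes xs)"
  unfolding scan_nodes_def by (rule sorted_wrt_concat_rows) (simp add: sorted_wrt_rev del: upt_Suc)

text \<open>Rows of larger index are read first. Hence every sign before \<open>A\<close> is a minus
  and every sign after it a plus: the signature is already reduced, with \<open>A\<close> as its
  rightmost minus.\<close>

lemma good_without_erasure:
  assumes A: "removable p i xs A"
    and above: "\<And>r c. r < fst A \<Longrightarrow> \<not> removable p i xs (r, c)"
    and right: "\<And>c. snd A < c \<Longrightarrow> \<not> removable p i xs (fst A, c)"
    and below: "\<And>r c. fst A < r \<Longrightarrow> \<not> addable p i xs (r, c)"
    and left: "\<And>c. c < snd A \<Longrightarrow> \<not> addable p i xs (fst A, c)"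
  shows "good p i xs A"
proof -
  have "A \<in> young xs" using A by (simp add: removable_def)
  then have "A \<in> set (scan_nodes xs)"
    by (cases A) (force simp: scan_nodes_def young_def part_def split: if_splits)
  then obtain k l where kl: "scan_nodes xs = k @ A # l" by (meson split_list)
  have sorted: "\<forall>B\<in>set k. fst A < fst B \<or> fst A = fst B \<and> snd B < snd A"
    "\<forall>B\<in>set l. fst B < fst A \<or> fst A = fst B \<and> snd A < snd B"
    using sorted_scan_nodes[of xs] unfolding kl by (auto simp: sorted_wrt_append)
  let ?g = "\<lambda>l. map (\<lambda>A. (if removable p i xs A then Minus else Plus, A))
       (filter (\<lambda>A. removable p i xs A \<or> addable p i xs A) l)"
  have sig: "signature p i xs = ?g k @ [(Minus, A)] @ ?g l"
    using A by (simp add: signature_def kl)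
  have "\<forall>x\<in>set (?g k). fst x = Minus"
    using sorted(1) below left by fastforce
  moreover have "\<forall>x\<in>set (?g l). fst x = Plus"
    using sorted(2) above right by fastforce
  ultimately show ?thesis
    unfolding good_def sig by blast
qed

text \<open>Parts \<open>z > x\<close> lie in the rows above and must not end in residue
  \<open>i\<close>. Parts \<open>z < x\<close>, with 0 for the empty row, lie below; there an added
  node would create a second part \<open>Suc z\<close> not divisible by \<open>p\<close>. The row 0
  inside \<open>res\<close> is a placeholder, since residues depend only on columns.\<close>

lemma crystal_edge_lower:
  assumes fin: "finite S" and nz: "0 \<notin> S" and x: "x \<in> S" "x - 1 \<notin> S"
    and res: "res p (0, x - 1) = i"
    and restricted: "p_restricted p (strict_partition S)"
      "p_restricted p (strict_partition (lower x S))"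
    and no_minus: "\<And>z. z \<in> S \<Longrightarrow> x < z \<Longrightarrow> res p (0, z - 1) \<noteq> i"
    and no_plus: "\<And>z. z \<in> insert 0 S \<Longrightarrow> z < x \<Longrightarrow> res p (0, z) = i \<Longrightarrow>
      Suc z \<in> S \<and> \<not> p dvd Suc z"
  shows "crystal_edge p i (strict_partition (lower x S)) (strict_partition S)"
proof -
  let ?xs = "strict_partition S" and ?r = "card {y \<in> S. x < y}"
  let ?A = "(?r, x - 1)"
  have x0: "0 < x" using nz x by (metis gr0I)
  have px: "part ?xs ?r = x" by (rule part_strict_partition[OF fin x(1)])
  then have A: "?A \<in> young ?xs" using x0 by (simp add: young_def)
  have yl: "young (strict_partition (lower x S)) = young ?xs - {?A}"
    by (rule young_lower[OF fin nz x])
  have "removable p i ?xs ?A"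
    unfolding removable_def p_strict_diagram_def using A res restricted(2) yl
    by (auto simp: p_restricted_def res_def)
  then have "good p i ?xs ?A"
  proof (rule good_without_erasure)
    fix r c assume "r < fst ?A"
    then have r: "r < ?r" by simp
    show "\<not> removable p i ?xs (r, c)"
    proof
      assume "removable p i ?xs (r, c)"
      from removable_residue[OF this]
      have z: "0 < part ?xs r" "res p (0, part ?xs r - 1) = i" by (auto simp: res_def)
      from r have "x < part ?xs r" using less_part_strict_partition[OF fin] by simp
      then show False using no_minus part_strict_partition_mem(1)[OF fin z(1)] z(2) by blast
    qed
  next
    fix c assume "snd ?A < c"
    then show "\<not> removable p i ?xs (fst ?A, c)"
      using px by (auto simp: removable_def young_def)
  next
    fix r c assume "fst ?A < r"
    then have r: "?r < r" by simp
    show "\<not> addable p i ?xs (r, c)"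
    proof
      assume "addable p i ?xs (r, c)"
      from addable_residue[OF this] have i: "res p (0, part ?xs r) = i"
        and d: "p_strict_diagram p (young ?xs \<union> {(r, part ?xs r)})" by (auto simp: res_def)
      have mem: "part ?xs r \<in> insert 0 S"
        using part_strict_partition_mem(1)[OF fin, of r] by (cases "part ?xs r") auto
      \<comment> \<open>The parts of size at least \<open>x\<close> occupy exactly the rows up to
        \<open>?r\<close>, so any later row has a part below \<open>x\<close>.\<close>
      have "{y \<in> S. x - 1 < y} = insert x {y \<in> S. x < y}" using x x0 by auto
      then have "card {y \<in> S. x - 1 < y} = Suc ?r" using fin by simp
      then have "part ?xs r < x"
        using r less_part_strict_partition[OF fin, of "x - 1" r] x0 by linarith
      from no_plus[OF mem this i] have "Suc (part ?xs r) \<in> S" "\<not> p dvd Suc (part ?xs r)"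
        by auto
      then show False
        using p_strict_add_node_dvd[OF d part_strict_partition[OF fin]] by blast
    qed
  next
    fix c assume "c < snd ?A"
    then show "\<not> addable p i ?xs (fst ?A, c)"
      using px by (auto simp: addable_def young_def)
  qed
  then show ?thesis unfolding crystal_edge_def using restricted yl by blast
qed

section \<open>Charges as invariants of bar removal\<close>

section \<open>Charges\<close>

definition bead :: "nat \<Rightarrow> nat \<Rightarrow> nat \<Rightarrow> int" where
  "bead p j x = of_bool (x mod p = j) - of_bool (x mod p = p - j)"

definition charge :: "nat \<Rightarrow> nat list \<Rightarrow> nat \<Rightarrow> int" where
  "charge p xs j = sum_list (map (bead p j) xs)"

lemma bead_0: "0 < j \<Longrightarrow> j < p \<Longrightarrow> bead p j 0 = 0"
  by (simp add: bead_def)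

lemma charge_mset: "charge p xs j = sum_mset (image_mset (bead p j) (mset xs))"
  by (simp add: charge_def flip: sum_mset_sum_list)

text \<open>A slide stays on its runner, a part \<open>p\<close> lies on the uncharged runner 0, and
  two parts with sum \<open>p\<close> lie on opposite runners (or both on runner 0), so their
  contributions cancel.\<close>

lemma remove_pbar_invariant:
  assumes "remove_pbar p xs ys" "0 < j" "j < p"
  shows "charge p xs j = charge p ys j" and "sum_list xs = sum_list ys + p"
proof -
  have "charge p xs j = charge p ys j \<and> sum_list xs = sum_list ys + p"
    using assms(1)
  proof cases
    case (slide x M)
    have "bead p j (x - p) = bead p j x"
      using slide(3) by (simp add: bead_def le_mod_geq)
    then show ?thesis
      using slide(3-5) by (simp add: charge_mset flip: sum_mset_sum_list)
  next
    case delete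
    then show ?thesis
      using assms(2,3) by (simp add: charge_mset bead_def flip: sum_mset_sum_list)
  next
    case (delete_pair x y)
    have "bead p j x + bead p j y = 0"
    proof (cases "x = p \<or> y = p")
      case True
      then show ?thesis using delete_pair(3) assms(2,3) by (auto simp: bead_def)
    next
      case False
      then have "x < p" "y = p - x" "0 < x" using delete_pair(3) by auto
      then show ?thesis using assms(2,3) by (auto simp: bead_def)
    qed
    then show ?thesis
      using delete_pair(3,4) by (simp add: charge_mset flip: sum_mset_sum_list)
  qed
  then show "charge p xs j = charge p ys j" and "sum_list xs = sum_list ys + p" by auto
qed

lemma remove_pbar_power_invariant:
  assumes "(remove_pbar p ^^ k) xs ys" "0 < j" "j < p"
  shows "charge p xs j = charge p ys j \<and> sum_list xs = sum_list ys + p * k"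
  using assms(1)
proof (induction k arbitrary: ys)
  case (Suc k)
  then obtain zs where zs: "(remove_pbar p ^^ k) xs zs" "remove_pbar p zs ys" by auto
  from Suc.IH[OF zs(1)] remove_pbar_invariant[OF zs(2) assms(2,3)] show ?case by simp
qed simp

lemma exists_core:
  assumes "1 < p" "p_strict p xs"
  shows "\<exists>b. has_core_weight p xs b"
  using assms(2)
proof (induction "sum_list xs" arbitrary: xs rule: less_induct)
  case less
  show ?case
  proof (cases "\<exists>ys. remove_pbar p xs ys")
    case False
    then have "has_core_weight p xs (xs, 0)"
      using less.prems by (simp add: has_core_weight_def pbar_core_def)
    then show ?thesis ..
  next
    case True
    then obtain ys where ys: "remove_pbar p xs ys" ..
    then have "p_strict p ys" by cases auto
    moreover have "sum_list ys < sum_list xs"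
      \<comment> \<open>The size clause also carries a runner index; 1 is an admissible
        choice.\<close>
      using remove_pbar_invariant(2)[OF ys, of 1] assms(1) by simp
    ultimately obtain b where "has_core_weight p ys b" using less.hyps by blast
    then have "has_core_weight p xs (fst b, Suc (snd b))"
      using relpowp_Suc_I2[where P = "remove_pbar p", OF ys] by (simp add: has_core_weight_def del: relpowp.simps)
    then show ?thesis ..
  qed
qed

section \<open>Cores as pushed-down abaci, their sizes and their tuples\<close>

section \<open>The structure of bar cores\<close>

text \<open>Supplies the target list of a bar removal when only its multiset of parts has been
  described.\<close>

lemma exists_p_strict_mset:
  assumes "0 \<notin># M" "\<And>x. 1 < count M x \<Longrightarrow> p dvd x"
  shows "\<exists>ys. p_strict p ys \<and> mset ys = M"
proof (intro exI conjI)
  let ?ys = "rev (sorted_list_of_multiset M)"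
  show m: "mset ?ys = M" by simp
  show "p_strict p ?ys"
    using assms sorted_sorted_list_of_multiset[of M] m
    by (auto simp: p_strict_def is_partition_def sorted_wrt_rev simp flip: count_mset)
qed

lemma p_strict_count:
  assumes "p_strict p xs" "\<not> p dvd x"
  shows "count (mset xs) x \<le> 1"
  using assms by (cases "x \<in> set xs") (auto simp: p_strict_def count_mset not_less)

text \<open>Each failure would permit a bar removal: sliding \<open>x\<close> down, deleting a part
  \<open>p\<close>, or deleting the pair \<open>x\<close>, \<open>p - x\<close>.\<close>

lemma pbar_core_beads:
  assumes core: "pbar_core p rho" and p: "odd p"
  shows "x \<in> set rho \<Longrightarrow> \<not> p dvd x"
    and "x \<in> set rho \<Longrightarrow> p < x \<Longrightarrow> x - p \<in> set rho"
    and "x \<in> set rho \<Longrightarrow> x < p \<Longrightarrow> p - x \<notin> set rho"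
proof -
  have st: "p_strict p rho" and no: "\<not> remove_pbar p rho ys" for ys
    using core by (auto simp: pbar_core_def)
  have nz: "0 \<notin> set rho" using st by (simp add: p_strict_def is_partition_def)
  have cnt: "p dvd x" if "1 < count (mset rho) x" for x
    using p_strict_count[OF st] that by fastforce
  have slide: "\<not> p dvd x \<and> x - p \<in> set rho" if x: "x \<in> set rho" "p < x" for x
  proof (rule ccontr)
    \<comment> \<open>If \<open>p\<close> divides \<open>x\<close>, then repeating
      \<open>x - p\<close> is harmless; otherwise \<open>x - p\<close> is vacant. Either way
      \<open>x\<close> could slide down.\<close>
    assume bad: "\<not> (\<not> p dvd x \<and> x - p \<in> set rho)"
    obtain M where M: "mset rho = add_mset x M"
      using x(1) by (metis in_multiset_in_set multi_member_split)
    have "\<exists>ys. p_strict p ys \<and> mset ys = add_mset (x - p) M"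
    proof (rule exists_p_strict_mset)
      show "0 \<notin># add_mset (x - p) M" using x(2) nz M by (auto simp flip: set_mset_mset)
      fix y assume y: "1 < count (add_mset (x - p) M) y"
      show "p dvd y"
      proof (cases "y = x - p \<and> \<not> p dvd x")
        case True
        then have "x - p \<notin> set rho" using bad by auto
        then have "count (mset rho) (x - p) = 0" by simp
        then show ?thesis using y True unfolding M
            by (auto simp: count_eq_zero_iff split: if_splits)
      next
        case False
        then consider "y = x - p" "p dvd x" | "y \<noteq> x - p" by auto
        then show ?thesis
        proof cases
          case 1
          then show ?thesis by simp
        next
          case 2
          then have "1 < count M y" using y by simp
          also have "count M y \<le> count (mset rho) y" unfolding M by simp
          finally show ?thesis by (rule cnt)
        qed
      qed
    qed
    then show False using remove_pbar.slide[OF st _ x(2) M] no by blast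
  qed
  then show "x \<in> set rho \<Longrightarrow> p < x \<Longrightarrow> x - p \<in> set rho" by blast
  have "p \<notin> set rho"
  proof
    assume "p \<in> set rho"
    then obtain M where M: "mset rho = add_mset p M" by (metis in_multiset_in_set multi_member_split)
    have "\<exists>ys. p_strict p ys \<and> mset ys = M"
    proof (rule exists_p_strict_mset)
      show "0 \<notin># M" using nz M by (auto simp flip: set_mset_mset)
      show "p dvd y" if "1 < count M y" for y 
        by (rule cnt, rule less_le_trans[OF that]) (simp add: M)
    qed
    then show False using remove_pbar.delete[OF st] no M by blast
  qed
  show "\<not> p dvd x" if x: "x \<in> set rho"
  proof (cases "p < x")
    case True
    then show ?thesis using slide x by blast
  next
    case False
    then have "x < p" "0 < x" using x nz \<open>p \<notin> set rho\<close> by (metis gr0I linorder_neqE_nat)+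
    then show ?thesis by (simp add: nat_dvd_not_less)
  qed
  show "p - x \<notin> set rho" if x: "x \<in> set rho" "x < p"
  proof
    assume px: "p - x \<in> set rho"
    \<comment> \<open>Oddness of \<open>p\<close> makes the two beads different, so both can be
      taken out of the multiset.\<close>
    have "p - x \<noteq> x"
    proof
      assume "p - x = x"
      then have "p = 2 * x" using x(2) by simp
      then show False using p by simp
    qed
    obtain M where M: "mset rho = add_mset x M" using x(1) by (metis in_multiset_in_set multi_member_split)
    then have "p - x \<in># M" using px \<open>p - x \<noteq> x\<close> by (auto simp flip: set_mset_mset)
    then obtain L where L: "M = add_mset (p - x) L" by (meson multi_member_split)
    have "\<exists>ys. p_strict p ys \<and> mset ys = L"
    proof (rule exists_p_strict_mset)
      show "0 \<notin># L" using nz M L by (auto simp flip: set_mset_mset)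
      show "p dvd y" if "1 < count L y" for y 
        by (rule cnt, rule less_le_trans[OF that]) (simp add: M L)
    qed
    then show False using remove_pbar.delete_pair[OF st, of _ x "p - x"] no M L x(2) by auto
  qed
qed

text \<open>The bead set of an abacus with all beads pushed down and runner 0 empty.\<close>

definition core_beads :: "nat \<Rightarrow> (nat \<Rightarrow> nat) \<Rightarrow> nat set" where
  "core_beads p k = {x. x mod p \<noteq> 0 \<and> x div p < k (x mod p)}"

lemma core_beads_image:
  assumes "0 < p"
  shows "core_beads p k = (\<lambda>(b, a). a * p + b) ` (SIGMA b:{1..<p}. {..<k b})"
proof (intro equalityI subsetI)
  fix x assume x: "x \<in> core_beads p k"
  have "x = (\<lambda>(b, a). a * p + b) (x mod p, x div p)" by simp
  moreover have "(x mod p, x div p) \<in> (SIGMA b:{1..<p}. {..<k b})"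
    using x assms by (simp add: core_beads_def)
  ultimately show "x \<in> (\<lambda>(b, a). a * p + b) ` (SIGMA b:{1..<p}. {..<k b})" by (rule image_eqI)
qed (auto simp: core_beads_def)

lemma finite_core_beads [simp]: "0 < p \<Longrightarrow> finite (core_beads p k)"
  by (simp add: core_beads_image)

text \<open>The beads of runner \<open>b\<close> form an arithmetic progression from
  \<open>b\<close> with step \<open>p\<close>; doubling avoids division.\<close>

lemma sum_core_beads:
  assumes "0 < p"
  shows "2 * int (\<Sum>(core_beads p k)) = (\<Sum>b=1..<p. int (k b) * (int p * (int (k b) - 1) + 2 * int b))"
proof -
  have inj: "inj_on (\<lambda>(b, a). a * p + b) (SIGMA b:{1..<p}. {..<k b})"
  proof (rule inj_onI, clarsimp)
    fix a b c d
    assume *: "b < p" "d < p" "a * p + b = c * p + d"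
    from arg_cong[OF *(3), of "\<lambda>x. x mod p"] have "b = d" using *(1,2) by simp
    then show "b = d \<and> a = c" using * by simp
  qed
  have "\<Sum>(core_beads p k) = (\<Sum>b=1..<p. \<Sum>a<k b. a * p + b)"
    unfolding core_beads_image[OF assms]
    by (subst sum.reindex[OF inj], subst sum.Sigma) (auto simp: case_prod_beta)
  moreover have "2 * int (\<Sum>a<n. a * p + b) = int n * (int p * (int n - 1) + 2 * int b)" for n b
    by (induction n) (simp_all add: algebra_simps)
  ultimately show ?thesis by (simp add: sum_distrib_left)
qed

text \<open>Multiplicities are ignored, which is harmless for cores because their parts are
  distinct.\<close>

definition runner_count :: "nat \<Rightarrow> nat list \<Rightarrow> nat \<Rightarrow> nat" where
  "runner_count p xs b = card {x \<in> set xs. x mod p = b}"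

lemma runner_count_core_beads:
  assumes "0 < b" "b < p"
  shows "card {x \<in> core_beads p k. x mod p = b} = k b"
proof -
  have "{x \<in> core_beads p k. x mod p = b} = (\<lambda>a. a * p + b) ` {..<k b}"
  proof (intro equalityI subsetI)
    fix x assume x: "x \<in> {x \<in> core_beads p k. x mod p = b}"
    then have "x = x div p * p + b" by auto
    then show "x \<in> (\<lambda>a. a * p + b) ` {..<k b}" using x by (auto simp: core_beads_def)
  qed (use assms in \<open>auto simp: core_beads_def\<close>)
  moreover have "inj (\<lambda>a. a * p + b)" using assms by (auto simp: inj_def)
  ultimately show ?thesis by (simp add: card_image inj_on_subset)
qed

lemma charge_distinct:
  assumes "distinct xs"
  shows "charge p xs j = int (runner_count p xs j) - int (runner_count p xs (p - j))"
proof -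
  have "charge p xs j = (\<Sum>x\<in>set xs. bead p j x)"
    using assms by (simp add: charge_def sum_list_distinct_conv_sum_set)
  then show ?thesis
    by (simp add: bead_def runner_count_def sum_subtractf of_bool_def sum.If_cases Int_def)
qed

text \<open>A repeated part would be a multiple of \<open>p\<close>, and a core has none.\<close>

lemma pbar_core_distinct:
  assumes "pbar_core p rho" "odd p"
  shows "distinct rho"
proof -
  have "count (mset rho) x = (if x \<in> set rho then 1 else 0)" for x
  proof (cases "x \<in> set rho")
    case True
    then have "0 < count (mset rho) x" by simp
    moreover have "count (mset rho) x \<le> 1"
      using p_strict_count pbar_core_beads(1)[OF assms True] assms(1) by (auto simp: pbar_core_def)
    ultimately have "count (mset rho) x = 1" by linarith
    then show ?thesis using True by simp
  qed simp
  then show ?thesis by (simp add: distinct_count_atmost_1)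
qed

lemma pbar_core_set:
  assumes core: "pbar_core p rho" and p: "odd p"
  shows "set rho = core_beads p (runner_count p rho)"
proof -
  have p0: "0 < p" using p by (cases p) auto
  have down: "y - d * p \<in> set rho" if "y \<in> set rho" "d \<le> y div p" for y d
    using that(2)
  proof (induction d)
    case (Suc d)
    then have IH: "y - d * p \<in> set rho" by simp
    have "Suc d * p \<le> y"
      using Suc.prems p0 by (simp only: less_eq_div_iff_mult_less_eq)
    then have "p \<le> y - d * p" by simp
    \<comment> \<open>Sliding requires a part strictly above \<open>p\<close>; the value
      \<open>p\<close> itself is excluded since a core contains no multiple of
      \<open>p\<close>.\<close>
    moreover have "y - d * p \<noteq> p" using pbar_core_beads(1)[OF assms IH] by auto
    ultimately have "p < y - d * p" by simp
    from pbar_core_beads(2)[OF assms IH this] show ?case by (simp add: add.commute)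
  qed (use that in simp)
  show ?thesis
  proof (intro equalityI subsetI)
    fix x assume x: "x \<in> set rho"
    \<comment> \<open>All positions below \<open>x\<close> on its runner are occupied, so the runner
      holds more than \<open>x div p\<close> beads.\<close>
    have "(\<lambda>d. x - d * p) ` {..x div p} \<subseteq> {y \<in> set rho. y mod p = x mod p}"
    proof clarsimp
      fix d assume d: "d \<le> x div p"
      then have "d * p \<le> x" using p0 by (simp only: less_eq_div_iff_mult_less_eq)
      then have "(x - d * p) mod p = x mod p"
        by (metis le_add_diff_inverse2 mod_mult_self1)
      then show "x - d * p \<in> set rho \<and> (x - d * p) mod p = x mod p" using down x d by blast
    qed
    moreover have "inj_on (\<lambda>d. x - d * p) {..x div p}"
    proof (rule inj_onI)
      fix a b assume *: "a \<in> {..x div p}" "b \<in> {..x div p}" "x - a * p = x - b * p"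
      then have "a * p \<le> x" "b * p \<le> x"
        using p0 by (simp_all only: atMost_iff less_eq_div_iff_mult_less_eq)
      then have "a * p = b * p" using *(3) by linarith
      then show "a = b" using p0 by simp
    qed
    ultimately have "Suc (x div p) \<le> card {y \<in> set rho. y mod p = x mod p}"
      using card_inj_on_le[of _ "{..x div p}" "{y \<in> set rho. y mod p = x mod p}"] by simp
    then show "x \<in> core_beads p (runner_count p rho)"
      using pbar_core_beads(1)[OF assms x]
      by (simp add: core_beads_def runner_count_def dvd_eq_mod_eq_0)
  next
    fix x assume x: "x \<in> core_beads p (runner_count p rho)"
    show "x \<in> set rho"
    proof (rule ccontr)
      assume nx: "x \<notin> set rho"
      \<comment> \<open>A bead above the vacant \<open>x\<close> would force \<open>x\<close> to be
        occupied. So all beads of the runner are lower, which are too few.\<close>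
      have "(\<lambda>y. y div p) ` {y \<in> set rho. y mod p = x mod p} \<subseteq> {..<x div p}"
      proof clarsimp
        fix y assume y: "y \<in> set rho" "y mod p = x mod p"
        show "y div p < x div p"
        proof (rule ccontr)
          assume "\<not> y div p < x div p"
          then have le: "x div p \<le> y div p" by simp
          have "y = y div p * p + x mod p" "x = x div p * p + x mod p"
            using div_mult_mod_eq[of y p] div_mult_mod_eq[of x p] y(2) by simp_all
          then have "x = y - (y div p - x div p) * p"
            using mult_le_mono1[OF le, of p] unfolding diff_mult_distrib by linarith
          then show False using down[OF y(1), of "y div p - x div p"] nx by simp
        qed
      qed
      moreover have "inj_on (\<lambda>y. y div p) {y \<in> set rho. y mod p = x mod p}"
      proof (rule inj_onI)
        fix y z assume "y \<in> {y \<in> set rho. y mod p = x mod p}"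
          "z \<in> {y \<in> set rho. y mod p = x mod p}" "y div p = z div p"
        then show "y = z" using div_mult_mod_eq[of y p] div_mult_mod_eq[of z p] by simp
      qed
      ultimately have "card {y \<in> set rho. y mod p = x mod p} \<le> x div p"
        using card_inj_on_le[of _ "{y \<in> set rho. y mod p = x mod p}" "{..<x div p}"] by simp
      then show False using x by (simp add: core_beads_def runner_count_def)
    qed
  qed
qed

text \<open>Two nonempty opposite runners would have bottom beads \<open>j\<close> and
  \<open>p - j\<close>, a removable pair.\<close>

lemma pbar_core_runner:
  assumes core: "pbar_core p rho" and p: "odd p" and j: "0 < j" "j < p"
  shows "runner_count p rho j = 0 \<or> runner_count p rho (p - j) = 0"
proof (rule ccontr)
  assume "\<not> ?thesis"
  then have "j \<in> set rho" "p - j \<in> set rho"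
    using j unfolding pbar_core_set[OF core p] by (auto simp: core_beads_def)
  then show False using pbar_core_beads(3)[OF core p] j by blast
qed

text \<open>One of two opposite runners is empty, so sign and absolute value of the charge give both
  bead counts.\<close>

lemma pbar_core_eqI:
  assumes "pbar_core p rho" "pbar_core p sigma" and p: "p = 2 * t + 1"
    and eq: "\<And>j. 1 \<le> j \<Longrightarrow> j \<le> t \<Longrightarrow> charge p rho j = charge p sigma j"
  shows "rho = sigma"
proof -
  have odd: "odd p" using p by simp
  have dist: "distinct rho" "distinct sigma"
    using assms(1,2) odd pbar_core_distinct by auto
  have half: "runner_count p rho j = runner_count p sigma j \<and>
      runner_count p rho (p - j) = runner_count p sigma (p - j)" if j: "1 \<le> j" "j \<le> t" for j
    using pbar_core_runner[OF assms(1) odd, of j] pbar_core_runner[OF assms(2) odd, of j]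
      eq[OF j] j p by (auto simp: charge_distinct dist)
  have "runner_count p rho b = runner_count p sigma b" if "0 < b" "b < p" for b
  proof (cases "b \<le> t")
    case False
    then show ?thesis using half[of "p - b"] that p by auto
  qed (use half that in simp)
  then have "core_beads p (runner_count p rho) = core_beads p (runner_count p sigma)"
    using p by (auto simp: core_beads_def)
  then have "set rho = set sigma" using assms(1,2) odd pbar_core_set by metis
  moreover have "sorted_wrt (\<ge>) rho" "sorted_wrt (\<ge>) sigma"
    using assms(1,2) by (auto simp: pbar_core_def p_strict_def is_partition_def)
  ultimately show ?thesis using dist strict_partition_set by metis
qed

text \<open>Twice the size of the core with charges \<open>n\<close>, which avoids the division by \<open>2\<close>.\<close>

definition energy :: "nat \<Rightarrow> (nat \<Rightarrow> int) \<Rightarrow> int" where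
  "energy t n = (\<Sum>j=1..t. n j * ((2 * int t + 1) * (n j - 1) + 2 * int j))"

text \<open>\<open>k\<close> beads on runner \<open>p - j\<close> mean charge \<open>-k\<close>, and
  \<open>k * (p * (k - 1) + 2 * (p - j))\<close> equals
  \<open>(-k) * (p * (-k - 1) + 2 * j)\<close>, so one formula serves both runners.\<close>

lemma pbar_core_energy:
  assumes core: "pbar_core p rho" and p: "p = 2 * t + 1"
  shows "2 * int (sum_list rho) = energy t (charge p rho)"
proof -
  have odd: "odd p" using p by simp
  note dist = pbar_core_distinct[OF core odd]
  let ?k = "\<lambda>b. int (runner_count p rho b)"
  let ?g = "\<lambda>b. ?k b * (int p * (?k b - 1) + 2 * int b)"
  have "{1..<p} = {1..t} \<union> {t+1..<p}" using p by auto
  then have "(\<Sum>b=1..<p. ?g b) = (\<Sum>b=1..t. ?g b) + (\<Sum>b=t+1..<p. ?g b)"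
    by (simp only:) (rule sum.union_disjoint, auto)
  also have "(\<Sum>b=t+1..<p. ?g b) = (\<Sum>j=1..t. ?g (p - j))"
    by (rule sum.reindex_bij_witness[of _ "\<lambda>j. p - j" "\<lambda>j. p - j"]) (use p in auto)
  finally have "(\<Sum>b=1..<p. ?g b) = (\<Sum>j=1..t. ?g j + ?g (p - j))" by (simp add: sum.distrib)
  also have "\<dots> = energy t (charge p rho)"
    unfolding energy_def
  proof (rule sum.cong[OF refl])
    fix j assume j: "j \<in> {1..t}"
    then have ip: "int (p - j) = int p - int j" using p by auto
    have P: "2 * int t + 1 = int p" using p by simp
    from j p have "runner_count p rho j = 0 \<or> runner_count p rho (p - j) = 0"
      by (intro pbar_core_runner[OF core odd]) auto
    then show "?g j + ?g (p - j) =
        charge p rho j * ((2 * int t + 1) * (charge p rho j - 1) + 2 * int j)"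
      unfolding P charge_distinct[OF dist] ip by (auto simp: algebra_simps)
  qed
  moreover have "sum_list rho = \<Sum>(core_beads p (runner_count p rho))"
    using sum_list_distinct_conv_sum_set[OF dist, of "\<lambda>x. x"]
    by (simp flip: pbar_core_set[OF core odd])
  ultimately show ?thesis using sum_core_beads[of p "runner_count p rho"] p by simp
qed

text \<open>The core with non-negative charges \<open>m 1\<close>, ..., \<open>m t\<close>: the
  runners \<open>p - j\<close> stay empty.\<close>

definition half_core :: "nat \<Rightarrow> (nat \<Rightarrow> nat) \<Rightarrow> nat set" where
  "half_core t m = core_beads (2 * t + 1) (\<lambda>b. if b \<le> t then m b else 0)"

lemma mem_half_core:
  "p = 2 * t + 1 \<Longrightarrow>
    x \<in> half_core t m \<longleftrightarrow> x mod p \<noteq> 0 \<and> x mod p \<le> t \<and> x div p < m (x mod p)"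
  by (auto simp: half_core_def core_beads_def split: if_splits)

lemma finite_half_core [simp]: "finite (half_core t m)"
  by (simp add: half_core_def)

lemma zero_notin_half_core [simp]: "0 \<notin> half_core t m"
  by (simp add: half_core_def core_beads_def)

lemma charge_half_core:
  assumes p: "p = 2 * t + 1" and j: "1 \<le> j" "j \<le> t"
  shows "charge p (strict_partition (half_core t m)) j = int (m j)"
proof -
  have "runner_count p (strict_partition (half_core t m)) b = (if b \<le> t then m b else 0)"
    if "0 < b" "b < p" for b
    using runner_count_core_beads[OF that] by (simp add: runner_count_def half_core_def p)
  then show ?thesis using p j by (simp add: charge_distinct)
qed

lemma half_core_down:
  assumes p: "p = 2 * t + 1" and x: "x \<in> half_core t m" "p \<le> x"
  shows "x - p \<in> half_core t m"
  using x by (auto simp: mem_half_core[OF p] le_mod_geq le_div_geq p)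

text \<open>Every removal is blocked: a slide would duplicate \<open>x - p\<close>, which is no
  multiple of \<open>p\<close>; runner 0 is empty; and two parts below \<open>p\<close> have sum at
  most \<open>2 * t\<close>.\<close>

lemma pbar_core_half_core:
  assumes p: "p = 2 * t + 1"
  shows "pbar_core p (strict_partition (half_core t m))"
proof -
  let ?S = "half_core t m" let ?rho = "strict_partition ?S"
  note mem = mem_half_core[OF p]
  have "False" if "remove_pbar p ?rho ys" for ys
    using that
  proof cases
    case (slide x M)
    then have x: "x \<in> ?S"
      by (metis finite_half_core set_mset_mset set_strict_partition union_single_eq_member add_mset_add_single union_commute)
    then have "x - p \<in> ?S" using half_core_down[OF p x] slide by simp
    then have nd: "\<not> p dvd x - p" and "x - p \<in># mset ?rho" by (auto simp: mem)
    then have "x - p \<in># M" using slide p by auto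
    then have "1 < count (mset ys) (x - p)" using slide by simp
    then show False using p_strict_count[OF slide(2) nd] by simp
  next
    case delete
    then have "p \<in># mset ?rho" by simp
    then show False by (simp add: mem)
  next
    case (delete_pair x y)
    then have "x \<in># mset ?rho" "y \<in># mset ?rho" by auto
    then have "x mod p \<noteq> 0" "x mod p \<le> t" "y mod p \<noteq> 0" "y mod p \<le> t" by (auto simp: mem)
    moreover from this have "x < p" "y < p" using delete_pair(3)
      by (metis le_add1 le_add2 le_neq_implies_less mod_self)+
    ultimately show False using delete_pair(3) p by simp
  qed
  then show ?thesis by (auto simp: pbar_core_def p_strict_strict_partition)
qed

text \<open>An empty runner receives second entry 1, hence the positivity of \<open>m\<close>. Given
  it, prescribing the tuple amounts to prescribing the charges, which yields existence and
  uniqueness for \<open>THE\<close>.\<close>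

lemma core_of_tuple_half_core:
  assumes p: "p = 2 * t + 1" and m: "\<And>i. 1 \<le> i \<Longrightarrow> i \<le> t \<Longrightarrow> 0 < m i"
  shows "core_of_tuple p (map (\<lambda>i. (m i, 0)) [1..<Suc t]) = strict_partition (half_core t m)"
proof -
  have odd: "odd p" and half: "(p - 1) div 2 = t" using p by simp_all
  have len: "length (filter (\<lambda>x. x mod p = j \<or> x mod p = p - j) rho) =
      runner_count p rho j + runner_count p rho (p - j)"
    if "pbar_core p rho" "1 \<le> j" "j \<le> t" for rho j
  proof -
    have "length (filter (\<lambda>x. x mod p = j \<or> x mod p = p - j) rho) =
        card ({x \<in> set rho. x mod p = j} \<union> {x \<in> set rho. x mod p = p - j})"
      using distinct_length_filter[OF pbar_core_distinct[OF that(1) odd], of "\<lambda>x. x mod p = j \<or> x mod p = p - j"]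
      by (simp add: Int_def conj_commute conj_disj_distribL Collect_disj_eq)
    also have "\<dots> = runner_count p rho j + runner_count p rho (p - j)"
      unfolding runner_count_def using that p by (intro card_Un_disjoint) auto
    finally show ?thesis .
  qed
  have tuple: "core_tuple p rho = map (\<lambda>i. (m i, 0)) [1..<Suc t] \<longleftrightarrow>
      (\<forall>j. 1 \<le> j \<and> j \<le> t \<longrightarrow> charge p rho j = int (m j))" if core: "pbar_core p rho" for rho
  proof -
    have "core_tuple p rho = map (\<lambda>i. (m i, 0)) [1..<Suc t] \<longleftrightarrow>
      (\<forall>j. 1 \<le> j \<and> j \<le> t \<longrightarrow> runner_count p rho j + runner_count p rho (p - j) = m j \<and>
        (\<exists>x\<in>set rho. x mod p = j))"
      unfolding core_tuple_def half map_eq_conv by (auto simp: len[OF core] simp del: upt_Suc)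
    also have "\<dots> \<longleftrightarrow> (\<forall>j. 1 \<le> j \<and> j \<le> t \<longrightarrow> charge p rho j = int (m j))"
    proof -
      have "runner_count p rho j + runner_count p rho (p - j) = m j \<and> (\<exists>x\<in>set rho. x mod p = j)
        \<longleftrightarrow> charge p rho j = int (m j)" if j: "1 \<le> j" "j \<le> t" for j
      proof -
        have "(\<exists>x\<in>set rho. x mod p = j) \<longleftrightarrow> runner_count p rho j \<noteq> 0"
          by (auto simp: runner_count_def)
        moreover have "runner_count p rho j = 0 \<or> runner_count p rho (p - j) = 0"
          using j p by (intro pbar_core_runner[OF core odd]) auto
        ultimately show ?thesis
          using m[OF j] unfolding charge_distinct[OF pbar_core_distinct[OF core odd]] by linarith
      qed
      then show ?thesis by blast
    qed
    finally show ?thesis .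
  qed
  show ?thesis
    unfolding core_of_tuple_def
  proof (rule the_equality)
    show "pbar_core p (strict_partition (half_core t m)) \<and>
        core_tuple p (strict_partition (half_core t m)) = map (\<lambda>i. (m i, 0)) [1..<Suc t]"
      using tuple pbar_core_half_core[OF p] charge_half_core[OF p] by blast
    fix rho assume rho: "pbar_core p rho \<and> core_tuple p rho = map (\<lambda>i. (m i, 0)) [1..<Suc t]"
    then have "pbar_core p rho" by blast
    then show "rho = strict_partition (half_core t m)"
    proof (rule pbar_core_eqI[OF _ pbar_core_half_core[OF p] p])
      fix j assume "1 \<le> j" "j \<le> t"
      then show "charge p rho j = charge p (strict_partition (half_core t m)) j"
        using tuple[of rho] rho by (simp only: charge_half_core[OF p]) blast
    qed
  qed
qed

section \<open>Effect of an edge on charges, rank and weight\<close>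

section \<open>Edges between blocks\<close>

lemma good_removable:
  assumes "good p i xs A"
  shows "removable p i xs A"
proof -
  have "set l \<subseteq> set (signature p i xs)" if "erase_pair\<^sup>*\<^sup>* (signature p i xs) l" for l
    using that by induction (auto elim!: erase_pair.cases)
  then have "(Minus, A) \<in> set (signature p i xs)"
    using assms unfolding good_def by fastforce
  then show ?thesis by (auto simp: signature_def split: if_splits)
qed

text \<open>Adding a node of residue \<open>i\<close> moves a bead from runner \<open>i\<close> to
  \<open>i + 1\<close>, or from \<open>p - 1 - i\<close> to \<open>p - i\<close>; both have the same
  effect on charges. For \<open>i = t\<close> the runners are \<open>t\<close> and
  \<open>p - t\<close>, whence the \<open>- 2\<close>. Only \<open>1 \<le> j \<le> t\<close> is
  meaningful.\<close>

definition charge_shift :: "nat \<Rightarrow> nat \<Rightarrow> nat \<Rightarrow> int" where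
  "charge_shift t i j = (if j = Suc i then 1 else if j \<noteq> i then 0 else if i = t then - 2 else - 1)"

lemma bead_Suc:
  assumes p: "p = 2 * t + 1" and j: "1 \<le> j" "j \<le> t" and r: "res p (0, a) = i"
  shows "bead p j (Suc a) - bead p j a = charge_shift t i j"
proof -
  define r where "r = a mod p"
  have rp: "r < p" using p by (simp add: r_def)
  have s: "Suc a mod p = (if Suc r = p then 0 else Suc r)"
    by (simp add: r_def mod_Suc)
  have i: "i = min r (p - 1 - r)" using \<open>res p (0, a) = i\<close> by (simp add: res_def r_def)
  show ?thesis
  proof (cases "r \<le> t")
    \<comment> \<open>The ascending half of the residue sequence, including its peak
      \<open>t\<close>.\<close>
    case True
    then have "i = r" using i p by linarith
    have "Suc a mod p = Suc r" using True s p j by simp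
    moreover have "r \<noteq> p - j" "Suc r = p - j \<longleftrightarrow> r = t \<and> j = t" using True p j by linarith+
    ultimately show ?thesis
      unfolding bead_def r_def[symmetric] charge_shift_def \<open>i = r\<close> by auto
  next
    case False
    then have "i < t" using i rp p by linarith
    have "r \<noteq> j" using False j by simp
    moreover have "r = p - j \<longleftrightarrow> j = Suc i" using False i rp p j by linarith
    moreover have "Suc a mod p \<noteq> j" using False s j by auto
    moreover have "Suc a mod p = p - j \<longleftrightarrow> j = i"
    proof (cases "Suc r = p")
      case True
      then have "i = 0" "Suc a mod p = 0" using i s by simp_all
      then show ?thesis using j p by simp
    next
      case False
      then have "Suc a mod p = Suc r" using s by simp
      then show ?thesis using False \<open>\<not> r \<le> t\<close> i rp p j by linarith
    qed
    ultimately show ?thesis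
      using \<open>i < t\<close> unfolding bead_def r_def[symmetric] charge_shift_def by auto
  qed
qed

text \<open>Only the summands \<open>i\<close> and \<open>i + 1\<close> within \<open>1..t\<close>
  change. The 2 is twice the added node, and the last factor is the loss of weight along the
  edge.\<close>

lemma energy_charge_shift:
  assumes "1 \<le> t" "i \<le> t" and m: "\<And>j. 1 \<le> j \<Longrightarrow> j \<le> t \<Longrightarrow> m j = n j + charge_shift t i j"
  shows "energy t m = energy t n + 2 + 2 * (2 * int t + 1) *
    (if i = 0 then n 1 else if i = t then 2 - 2 * n t else n (Suc i) - n i + 1)"
proof -
  let ?E = "\<lambda>j x. x * ((2 * int t + 1) * (x - 1) + 2 * int j)"
  let ?D = "\<lambda>j. ?E j (n j + charge_shift t i j) - ?E j (n j)"
  have "energy t m - energy t n = (\<Sum>j=1..t. ?D j)"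
    unfolding energy_def sum_subtractf[symmetric] by (intro sum.cong) (simp_all add: m)
  also have "\<dots> = sum ?D ({i, Suc i} \<inter> {1..t})"
    by (rule sum.mono_neutral_right) (auto simp: charge_shift_def)
  also have "\<dots> = 2 + 2 * (2 * int t + 1) *
    (if i = 0 then n 1 else if i = t then 2 - 2 * n t else n (Suc i) - n i + 1)"
  proof -
    consider "i = 0" | "0 < i" "i = t" | "0 < i" "i < t" using assms(2) by linarith
    then show ?thesis
    proof cases
      case 1
      then have "{i, Suc i} \<inter> {1..t} = {1}" using assms(1) by auto
      then show ?thesis using 1 by (simp add: charge_shift_def algebra_simps)
    next
      case 2
      then have "{i, Suc i} \<inter> {1..t} = {t}" by auto
      then show ?thesis using 2 by (simp add: charge_shift_def algebra_simps)
    next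
      case 3
      then have "{i, Suc i} \<inter> {1..t} = {i, Suc i}" by auto
      then show ?thesis using 3 by (simp add: charge_shift_def algebra_simps)
    qed
  qed
  finally show ?thesis by simp
qed

lemma block_edge_invariants:
  assumes edge: "block_edge p i b c" and p: "p = 2 * t + 1" and t: "1 \<le> t"
  shows "\<And>j. 1 \<le> j \<Longrightarrow> j \<le> t \<Longrightarrow>
      charge p (fst c) j = charge p (fst b) j + charge_shift t i j"
    and "rank p c = rank p b + 1"
proof -
  obtain ys xs A where g: "good p i xs A" and y: "young ys = young xs - {A}"
    and b: "(remove_pbar p ^^ snd b) ys (fst b)" and c: "(remove_pbar p ^^ snd c) xs (fst c)"
    using edge by (auto simp: block_edge_def crystal_edge_def has_core_weight_def)
  have rem: "removable p i xs A" by (rule good_removable[OF g])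
  then have A: "A \<in> young xs" by (simp add: removable_def)
  \<comment> \<open>Under clause (2), too, the removed node itself has residue
    \<open>i = 0\<close>.\<close>
  have r: "res p (0, snd A) = i"
    using rem by (auto simp: removable_def Let_def res_def)
  show "charge p (fst c) j = charge p (fst b) j + charge_shift t i j" if j: "1 \<le> j" "j \<le> t" for j
  proof -
    have jp: "0 < j" "j < p" using j p by auto
    have "charge p xs j = charge p ys j + charge_shift t i j"
      unfolding charge_def
      using sum_list_remove_node[of "bead p j", OF bead_0[OF jp] A y] bead_Suc[OF p j r] by simp
    then show ?thesis
      using remove_pbar_power_invariant[OF b jp] remove_pbar_power_invariant[OF c jp] by simp
  qed
  have "int (sum_list xs) = int (sum_list ys) + 1"
    using sum_list_remove_node[of int, OF _ A y] by (simp add: sum_list_of_nat)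
  moreover have "0 < (1::nat)" "1 < p" using p t by simp_all
  note remove_pbar_power_invariant[OF b this] remove_pbar_power_invariant[OF c this]
  ultimately have "int (sum_list (fst c) + p * snd c) = int (sum_list (fst b) + p * snd b + 1)"
    by simp
  then show "rank p c = rank p b + 1" unfolding rank_def of_nat_eq_iff .
qed

lemma block_edge_is_block:
  "block_edge p i b c \<Longrightarrow> is_block p b \<and> is_block p c"
  by (auto simp: block_edge_def is_block_def has_core_weight_def)

text \<open>The charges fix the new core size and the rank rises by 1, which forces the new
  weight.\<close>

lemma block_edge_weight:
  assumes edge: "block_edge p i b c" and p: "p = 2 * t + 1" and t: "1 \<le> t" and i: "i \<le> t"
  defines "n \<equiv> charge p (fst b)"
  shows "int (snd c) = int (snd b) -
    (if i = 0 then n 1 else if i = t then 2 - 2 * n t else n (Suc i) - n i + 1)" (is "_ = _ - ?d")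
proof -
  have cores: "pbar_core p (fst b)" "pbar_core p (fst c)"
    using block_edge_is_block[OF edge] by (auto simp: is_block_def)
  have "energy t (charge p (fst c)) = energy t n + 2 + 2 * (2 * int t + 1) * ?d"
    by (rule energy_charge_shift[OF t i]) (simp add: n_def block_edge_invariants(1)[OF edge p t])
  then have "2 * int (sum_list (fst c)) = 2 * int (sum_list (fst b)) + 2 + 2 * int p * ?d"
    using pbar_core_energy[OF cores(1) p] pbar_core_energy[OF cores(2) p] p by (simp add: n_def)
  moreover have "int (sum_list (fst c)) + int p * int (snd c) =
      int (sum_list (fst b)) + int p * int (snd b) + 1"
    using arg_cong[OF block_edge_invariants(2)[OF edge p t], of int] by (simp add: rank_def)
  ultimately have "int p * int (snd c) = int p * (int (snd b) - ?d)"
    by (simp add: right_diff_distrib)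
  then show ?thesis using p by (simp only: mult_cancel_left) auto
qed

text \<open>Incoming edges lower the rank when followed backwards, so every block is the last one of
  a string that cannot be extended at its beginning.\<close>

lemma at_max_end_iff:
  assumes p: "p = 2 * t + 1" and t: "1 \<le> t" and b: "is_block p b"
  shows "at_max_end p i b \<longleftrightarrow> (\<nexists>c. block_edge p i b c)"
proof -
  have string: "\<exists>bs. bs \<noteq> [] \<and> (\<forall>a\<in>set bs. is_block p a) \<and> successively (block_edge p i) bs \<and>
      (\<nexists>a. block_edge p i a (hd bs)) \<and> last bs = b"
    using b
  proof (induction "rank p b" arbitrary: b rule: less_induct)
    case less
    show ?case
    proof (cases "\<exists>a. block_edge p i a b")
      case False
      then show ?thesis using less.prems by (intro exI[of _ "[b]"]) auto
    next
      case True
      then obtain a where a: "block_edge p i a b" ..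
      then have "rank p a < rank p b" "is_block p a"
        using block_edge_invariants(2)[OF a p t] block_edge_is_block[OF a] by auto
      from less.hyps[OF this] obtain bs where "bs \<noteq> []" "\<forall>a\<in>set bs. is_block p a"
        "successively (block_edge p i) bs" "\<nexists>a. block_edge p i a (hd bs)" "last bs = a" by blast
      then show ?thesis using less.prems a
        by (intro exI[of _ "bs @ [b]"]) (auto simp: successively_append_iff)
    qed
  qed
  then show ?thesis unfolding at_max_end_def maximal_string_def by metis
qed

section \<open>Convexity: the vertex maximises the core size\<close>

section \<open>Maximal size\<close>

text \<open>The weights \<open>2 * j - t - 1\<close> change sign under \<open>j\<close> to
  \<open>t + 1 - j\<close>. Averaging with the reflected sum gives products of factors with equal
  sign.\<close>

lemma chebyshev_centered:
  fixes d :: "nat \<Rightarrow> int"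
  assumes mono: "\<And>i j. 1 \<le> i \<Longrightarrow> i \<le> j \<Longrightarrow> j \<le> t \<Longrightarrow> d i \<le> d j"
  shows "0 \<le> (\<Sum>j=1..t. d j * (2 * int j - int t - 1))" (is "0 \<le> ?S")
proof -
  have "?S = (\<Sum>j=1..t. d (Suc t - j) * (2 * int (Suc t - j) - int t - 1))"
    by (rule sum.reindex_bij_witness[of _ "\<lambda>j. Suc t - j" "\<lambda>j. Suc t - j"]) auto
  also have "\<dots> = (\<Sum>j=1..t. - d (Suc t - j) * (2 * int j - int t - 1))"
    by (rule sum.cong) (auto simp: of_nat_diff algebra_simps)
  finally have "2 * ?S = (\<Sum>j=1..t. (d j - d (Suc t - j)) * (2 * int j - int t - 1))"
    by (simp add: left_diff_distrib sum_subtractf sum_negf)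
  also have "0 \<le> \<dots>"
  proof (rule sum_nonneg)
    fix j assume j: "j \<in> {1..t}"
    show "0 \<le> (d j - d (Suc t - j)) * (2 * int j - int t - 1)"
    proof (cases "Suc t - j \<le> j")
      case True
      then show ?thesis using mono[of "Suc t - j" j] j by (intro mult_nonneg_nonneg) auto
    next
      case False
      then show ?thesis using mono[of j "Suc t - j"] j by (intro mult_nonpos_nonpos) auto
    qed
  qed
  finally show ?thesis by simp
qed

text \<open>With \<open>d\<^sub>j = 1 + j (w - 1) - n\<^sub>j\<close> the hypotheses say that \<open>d\<close> is non-negative and increasing with a
  bounded last term, and the difference of the two energies is estimated from below by a sum to
  which Chebyshev's inequality applies.\<close>

lemma energy_less:
  fixes n :: "nat \<Rightarrow> int" and w :: int
  assumes w: "1 \<le> w"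
    and first: "n 1 \<le> w"
    and step: "\<And>i. 1 \<le> i \<Longrightarrow> i < t \<Longrightarrow> n (Suc i) \<le> n i + w - 1"
    and last: "2 - w \<le> 2 * n t"
    and neq: "1 \<le> k" "k \<le> t" "n k \<noteq> 1 + int k * (w - 1)"
  shows "energy t n < energy t (\<lambda>j. 1 + int j * (w - 1))"
proof -
  define p where "p = 2 * int t + 1"
  define m where "m = (\<lambda>j. 1 + int j * (w - 1))"
  define d where "d j = m j - n j" for j
  have mono: "d i \<le> d j" if "1 \<le> i" "i \<le> j" "j \<le> t" for i j
    using that(2,3,1)
  proof (induction j rule: dec_induct)
    case (step j)
    then show ?case using assms(3)[of j] by (simp add: d_def m_def algebra_simps)
  qed simp
  have "d 1 \<ge> 0" using first by (simp add: d_def m_def)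
  then have nonneg: "d j \<ge> 0" if "1 \<le> j" "j \<le> t" for j
    using mono[of 1 j] that by simp
  have top: "2 * d j \<le> 2 * int t * (w - 1) + w" if "1 \<le> j" "j \<le> t" for j
    using mono[of j t] that last by (simp add: d_def m_def algebra_simps)
  let ?L = "\<lambda>j. 2 * p * (w - 1) * (d j * (2 * int j - int t - 1)) + d j * (p * w + 4 * int j)"
  have "0 < (\<Sum>j=1..t. d j * (p * w + 4 * int j))"
  proof (rule sum_pos2[of _ k])
    have "0 < d k" using nonneg[OF neq(1,2)] neq(3) by (simp add: d_def m_def)
    moreover have "0 < p * w + 4 * int k" using w by (simp add: p_def add_pos_nonneg)
    ultimately show "0 < d k * (p * w + 4 * int k)" by simp
    show "0 \<le> d j * (p * w + 4 * int j)" if "j \<in> {1..t}" for j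
      using nonneg[of j] that w by (simp add: p_def)
  qed (use neq in auto)
  moreover have "0 \<le> 2 * p * (w - 1) * (\<Sum>j=1..t. d j * (2 * int j - int t - 1))"
    using chebyshev_centered[of t d] mono w by (simp add: p_def)
  ultimately have "0 < (\<Sum>j=1..t. ?L j)"
    by (simp add: sum.distrib flip: sum_distrib_left)
  also have "\<dots> \<le> (\<Sum>j=1..t. 2 * (m j * (p * (m j - 1) + 2 * int j) - n j * (p * (n j - 1) + 2 * int j)))"
  proof (rule sum_mono)
    fix j assume "j \<in> {1..t}"
    then have j: "1 \<le> j" "j \<le> t" by auto
    have n: "n j = m j - d j" by (simp add: d_def)
    \<comment> \<open>This product is exactly the difference of the two summands being
      compared.\<close>
    have "0 \<le> p * d j * (2 * int t * (w - 1) + w - 2 * d j)"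
      using top[OF j] nonneg[OF j] by (simp add: p_def)
    then show "?L j \<le> 2 * (m j * (p * (m j - 1) + 2 * int j) - n j * (p * (n j - 1) + 2 * int j))"
      unfolding n m_def by (simp add: algebra_simps)
  qed
  also have "\<dots> = 2 * (energy t m - energy t n)"
    by (simp add: energy_def p_def sum_subtractf right_diff_distrib flip: sum_distrib_left)
  finally show ?thesis unfolding m_def by simp
qed

section \<open>Explicit crystal edges starting at the vertex block\<close>

section \<open>Existence of edges\<close>

lemma half_core_gap:
  assumes p: "p = 2 * t + 1" and z: "z \<in> half_core t m"
  shows "\<not> p dvd z" and "z < p \<or> z - p \<in> half_core t m"
  using half_core_down[OF p z] z by (auto simp: mem_half_core[OF p] dvd_eq_mod_eq_0)

text \<open>Gaps equal to \<open>p\<close> are permitted because no part is a multiple of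
  \<open>p\<close>.\<close>

lemma p_restricted_half_core:
  assumes p: "p = 2 * t + 1"
  shows "p_restricted p (strict_partition (half_core t m))"
proof (rule p_restricted_strict_partition; simp?)
  fix z assume z: "z \<in> half_core t m"
  then have "z \<noteq> 0" using zero_notin_half_core by metis
  then show "0 < z \<and> z \<le> p \<and> (p dvd z \<longrightarrow> z < p) \<or>
      (\<exists>y\<in>half_core t m. y < z \<and> z \<le> y + p \<and> (p dvd z \<longrightarrow> z < y + p))"
    using half_core_gap[OF p z] p by (cases "z < p") (auto intro!: bexI[of _ "z - p"])
qed

lemma edge_to_core:
  assumes p: "p = 2 * t + 1" and i: "i < t"
    and b: "pbar_core p rho" "\<And>j. 1 \<le> j \<Longrightarrow> j \<le> t \<Longrightarrow> charge p rho j = 1 + int j * (int w - 1)"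
    and w: "1 \<le> w"
  shows "\<exists>c. block_edge p i (rho, w) c"
proof -
  have t: "1 \<le> t" using i by simp
  \<comment> \<open>The charges of \<open>rho\<close> after adding a node of residue
    \<open>i\<close>; the core with these charges is the upper end of the edge.\<close>
  define m where "m j = (if j = Suc i then 2 + j * (w - 1) else if j = i then j * (w - 1)
    else 1 + j * (w - 1))" for j
  define S where "S = half_core t m"
  \<comment> \<open>The top bead of runner \<open>i + 1\<close>; heights start at 0, so it is one
    less than the bead count.\<close>
  define x where "x = (1 + Suc i * (w - 1)) * p + Suc i"
  have mem: "z \<in> S \<longleftrightarrow> z mod p \<noteq> 0 \<and> z mod p \<le> t \<and> z div p < m (z mod p)" for z
    unfolding S_def by (rule mem_half_core[OF p])
  have fin: "finite S" and nz: "0 \<notin> S" by (simp_all add: S_def)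
  have ip: "Suc i < p" using i p by simp
  have md: "(a * p + b) mod p = b" "(a * p + b) div p = a" if "b < p" for a b
    using that by simp_all
  have x_mod: "x mod p = Suc i" and x_div: "x div p = 1 + Suc i * (w - 1)"
    unfolding x_def by (rule md[OF ip])+
  have x1: "x - 1 = (1 + Suc i * (w - 1)) * p + i" by (simp add: x_def)
  have x1_mod: "(x - 1) mod p = i" and x1_div: "(x - 1) div p = 1 + Suc i * (w - 1)"
    unfolding x1 by (rule md[OF Suc_lessD[OF ip]])+
  have x: "x \<in> S" using x_mod x_div i by (simp add: mem m_def)
  have x1S: "x - 1 \<notin> S" using x1_mod x1_div by (simp add: mem m_def)
  have px: "p \<le> x" by (simp add: x_def)
  have top: "z \<le> x" if "z \<in> S" "z mod p = Suc i" for z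
  proof -
    have "z div p \<le> 1 + Suc i * (w - 1)" using that by (simp add: mem m_def)
    then have "z div p * p \<le> (1 + Suc i * (w - 1)) * p" by (rule mult_le_mono1)
    then show ?thesis using div_mult_mod_eq[of z p] that(2) unfolding x_def by linarith
  qed
  have "crystal_edge p i (strict_partition (lower x S)) (strict_partition S)"
  proof (rule crystal_edge_lower[OF fin nz x x1S])
    show "res p (0, x - 1) = i" using x1_mod i p by (simp add: res_def)
    show "p_restricted p (strict_partition S)" unfolding S_def by (rule p_restricted_half_core[OF p])
    show "p_restricted p (strict_partition (lower x S))"
    proof (rule p_restricted_strict_partition)
      show "finite (lower x S)" "0 \<notin> lower x S" using fin nz by (auto simp: lower_def)
      fix z assume "z \<in> lower x S"
      then consider "z = x - 1" | "z \<in> S" "z \<noteq> x" by (auto simp: lower_def)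
      then show "\<exists>y\<in>insert 0 (lower x S). y < z \<and> z \<le> y + p \<and> (p dvd z \<longrightarrow> z < y + p)"
      proof cases
        case 1
        \<comment> \<open>The gap from \<open>x - p\<close> to \<open>x - 1\<close> is
          \<open>p - 1\<close>, which suffices even for \<open>i = 0\<close>, where \<open>p\<close>
          divides \<open>x - 1\<close>.\<close>
        have "x - p \<in> S" using half_core_down[OF p] x px by (simp add: S_def)
        then have "x - p \<in> lower x S" using p px by (auto simp: lower_def)
        then show ?thesis using 1 px p t by (intro bexI[of _ "x - p"]) auto
      next
        case 2
        then have nd: "\<not> p dvd z" and z: "z < p \<or> z - p \<in> S"
          using half_core_gap[OF p] by (auto simp: S_def)
        show ?thesis
        proof (cases "z < p")
          case True
          then show ?thesis using nd by (intro bexI[of _ 0]) (auto intro: gr0I)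
        next
          case False
          have "z - p \<noteq> x"
          proof
            assume "z - p = x"
            then have "z = x + p" using False by simp
            then have "z mod p = Suc i" "x < z" using x_mod ip by simp_all
            then show False using top[OF 2(1)] by simp
          qed
          then have "z - p \<in> lower x S" using z False by (auto simp: lower_def)
          then show ?thesis using nd False p by (intro bexI[of _ "z - p"]) auto
        qed
      qed
    qed
    show "res p (0, z - 1) \<noteq> i" if z: "z \<in> S" "x < z" for z
    proof
      assume "res p (0, z - 1) = i"
      moreover have zm: "0 < z mod p" "z mod p \<le> t" using z by (auto simp: mem)
      moreover have "(z - 1) mod p = z mod p - 1"
      proof -
        have "z - 1 = z div p * p + (z mod p - 1)"
          using div_mult_mod_eq[of z p] zm(1) by linarith
        then show ?thesis using zm p by (metis mod_mult_self3 mod_less less_imp_diff_less mod_less_divisor zero_less_Suc Suc_eq_plus1)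
      qed
      ultimately have "z mod p = Suc i" using i p by (auto simp: res_def min_def split: if_splits)
      then show False using top z by fastforce
    qed
    show "Suc z \<in> S \<and> \<not> p dvd Suc z"
      if z: "z \<in> insert 0 S" "z < x" "res p (0, z) = i" for z
    proof (cases "z = 0")
      case True
      then have "i = 0" using z(3) by (simp add: res_def)
      then show ?thesis using True p t by (simp add: mem m_def)
    next
      case False
      then have zS: "z mod p \<noteq> 0" "z mod p \<le> t" "z div p < m (z mod p)" using z(1) by (auto simp: mem)
      then have zi: "z mod p = i" using z(3) i p by (auto simp: res_def min_def split: if_splits)
      then have sm: "Suc z mod p = Suc i" using i p by (simp add: mod_Suc)
      then have sd: "Suc z div p = z div p" by (simp add: div_Suc)
      \<comment> \<open>Runner \<open>i + 1\<close> is filled at least as high as runner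
        \<open>i\<close>, so the neighbour \<open>Suc z\<close> is occupied.\<close>
      have "z div p < m (Suc i)" using zS(3) zi by (simp add: m_def)
      then show ?thesis using sm sd i by (simp add: mem dvd_eq_mod_eq_0)
    qed
  qed
  moreover have core: "pbar_core p (strict_partition S)"
    unfolding S_def by (rule pbar_core_half_core[OF p])
  then have "has_core_weight p (strict_partition S) (strict_partition S, 0)"
    by (simp add: has_core_weight_def)
  moreover have "finite (lower x S)" "0 \<notin> lower x S" using fin nz by (auto simp: lower_def)
  then have "\<exists>b. has_core_weight p (strict_partition (lower x S)) b"
    using p t by (intro exists_core p_strict_strict_partition) auto
  then obtain b where "has_core_weight p (strict_partition (lower x S)) b" ..
  ultimately have edge: "block_edge p i b (strict_partition S, 0)"
    unfolding block_edge_def by blast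
  \<comment> \<open>The lower end is identified without removing bars: undoing the charge shift
    gives its core, and the weight formula with final weight 0 gives its weight.\<close>
  have charge_b: "charge p (fst b) j = 1 + int j * (int w - 1)" if "1 \<le> j" "j \<le> t" for j
    using block_edge_invariants(1)[OF edge p t that] charge_half_core[OF p that, of m] w i
    by (auto simp: S_def m_def charge_shift_def of_nat_diff split: if_splits)
      (simp add: algebra_simps)
  have "fst b = rho"
    using block_edge_is_block[OF edge] b charge_b p
    by (intro pbar_core_eqI[of p _ _ t]) (auto simp: is_block_def)
  moreover have "snd b = w"
    using block_edge_weight[OF edge p t less_imp_le[OF i]] charge_b i
    by (cases "i = 0") (auto simp: algebra_simps)
  ultimately have "b = (rho, w)" by (simp add: prod_eq_iff)
  then show ?thesis using edge by blast
qed

text \<open>The edge replaces the part \<open>t\<close> by \<open>t + 1\<close>. The bound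
  \<open>w \<le> m 1\<close> places \<open>(w - 1) * p + 1\<close> within distance
  \<open>p - 1\<close> of the adjoined part \<open>w * p\<close>; \<open>0 < m t\<close> provides
  the part \<open>t\<close>.\<close>

lemma edge_from_core_with_part:
  assumes p: "p = 2 * t + 1" and t: "1 \<le> t" and w: "1 \<le> w" and m: "w \<le> m 1" "0 < m t"
  shows "\<exists>c. block_edge p t (strict_partition (half_core t m), w) c"
proof -
  define H where "H = half_core t m"
  define S where "S = insert (t + 1) (insert (w * p) (H - {t}))"
  have mem: "z \<in> H \<longleftrightarrow> z mod p \<noteq> 0 \<and> z mod p \<le> t \<and> z div p < m (z mod p)" for z
    unfolding H_def by (rule mem_half_core[OF p])
  have wp: "p \<le> w * p" using w by simp
  have tp: "t < p" "t + 1 < p" using p t by simp_all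
  have tH: "t \<in> H" "t + 1 \<notin> H" "w * p \<notin> H" using tp t m by (simp_all add: mem)
  have finH: "finite H" and nzH: "0 \<notin> H" by (auto simp: H_def)
  have fin: "finite S" and nz: "0 \<notin> S" using finH nzH w p by (auto simp: S_def)
  have low: "lower (t + 1) S = insert (w * p) H"
    using tH t p wp by (auto simp: lower_def S_def)
  have runner1: "(w - 1) * p + 1 \<in> H" 
  proof -
    have "((w - 1) * p + 1) mod p = 1" "((w - 1) * p + 1) div p = w - 1"
      using tp t by (simp_all only: mod_mult_self3 div_mult_self3 mod_less div_less)
    then show ?thesis using t w m unfolding mem by simp
  qed
  have wp_eq: "w * p = (w - 1) * p + p" using w by (metis add.commute le_add_diff_inverse2 mult_Suc plus_1_eq_Suc)
  have gapH: "\<not> p dvd z" "z < p \<or> z - p \<in> H" "0 < z" if "z \<in> H" for z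
    using half_core_gap[OF p] that nzH by (auto simp: H_def intro: gr0I)
  have edge: "crystal_edge p t (strict_partition (lower (t + 1) S)) (strict_partition S)"
  proof (rule crystal_edge_lower[OF fin nz])
    show "t + 1 \<in> S" by (simp add: S_def)
    show "t + 1 - 1 \<notin> S" using wp p by (auto simp: S_def)
    show "res p (0, t + 1 - 1) = t" using p by (simp add: res_def)
    show "p_restricted p (strict_partition S)"
    proof (rule p_restricted_strict_partition[OF fin nz])
      fix z assume "z \<in> S"
      then consider "z = t + 1" | "z = w * p" | "z \<in> H" "z \<noteq> t" by (auto simp: S_def)
      then show "\<exists>y\<in>insert 0 S. y < z \<and> z \<le> y + p \<and> (p dvd z \<longrightarrow> z < y + p)"
      proof cases
        case 1
        then show ?thesis using p t by (intro bexI[of _ 0]) (auto dest: dvd_imp_le)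
      next
        case 2
        show ?thesis
        \<comment> \<open>If the supporting part is \<open>t\<close> itself, it is absent from
          \<open>S\<close>; then \<open>w = 1\<close> and \<open>t + 1\<close> takes over its
          role.\<close>
        proof (cases "(w - 1) * p + 1 = t")
          case True
          then have "(w - 1) * p < p" using p by simp
          then have "w = 1" using w by (cases "w - 1") auto
          then show ?thesis using 2 p t by (intro bexI[of _ "t + 1"]) (auto simp: S_def)
        next
          case False
          then have "(w - 1) * p + 1 \<in> S" using runner1 by (simp add: S_def)
          then show ?thesis using 2 wp_eq p t by (intro bexI[of _ "(w - 1) * p + 1"]) auto
        qed
      next
        case 3
        show ?thesis
        proof (cases "z < p")
          case True
          then show ?thesis using gapH[OF 3(1)] by (intro bexI[of _ 0]) auto
        next
          case False
          then have zp: "z - p \<in> H" using gapH[OF 3(1)] by simp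
          show ?thesis
          \<comment> \<open>The missing \<open>t\<close> is again replaced by \<open>t + 1\<close>,
            at distance \<open>p - 1\<close>.\<close>
          proof (cases "z - p = t")
            case True
            then show ?thesis using False gapH[OF 3(1)] p t
              by (intro bexI[of _ "t + 1"]) (auto simp: S_def)
          next
            case neq: False
            then have "z - p \<in> S" using zp by (simp add: S_def)
            then show ?thesis using False gapH[OF 3(1)] p by (intro bexI[of _ "z - p"]) auto
          qed
        qed
      qed
    qed
    show "p_restricted p (strict_partition (lower (t + 1) S))"
      unfolding low
    proof (rule p_restricted_strict_partition)
      show "finite (insert (w * p) H)" "0 \<notin> insert (w * p) H" using finH nzH w p by auto
      fix z assume "z \<in> insert (w * p) H"
      then consider "z = w * p" | "z \<in> H" by auto
      then show "\<exists>y\<in>insert 0 (insert (w * p) H). y < z \<and> z \<le> y + p \<and> (p dvd z \<longrightarrow> z < y + p)"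
      proof cases
        case 1
        then show ?thesis using runner1 wp_eq p t by (intro bexI[of _ "(w - 1) * p + 1"]) auto
      next
        case 2
        then show ?thesis using gapH[OF 2] p
          by (cases "z < p") (auto intro: bexI[of _ 0] intro!: bexI[of _ "z - p"])
      qed
    qed
    \<comment> \<open>Residue \<open>t\<close> occurs once per period, so \<open>z\<close> would lie
      on runner \<open>t + 1\<close>, where \<open>t + 1\<close> is the only part of
      \<open>S\<close>.\<close>
    show "res p (0, z - 1) \<noteq> t" if z: "z \<in> S" "t + 1 < z" for z
    proof
      assume "res p (0, z - 1) = t"
      then have "min ((z - 1) mod p) (p - 1 - (z - 1) mod p) = t" by (simp add: res_def)
      then have "(z - 1) mod p = t" using p t by linarith
      then have "Suc (z - 1) mod p = t + 1" using p t by (simp add: mod_Suc)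
      then have "z mod p = t + 1" using z(2) by simp
      moreover have "z = w * p \<or> z \<in> H" using z by (auto simp: S_def)
      ultimately show False by (auto simp: mem)
    qed
    show "Suc z \<in> S \<and> \<not> p dvd Suc z"
      if z: "z \<in> insert 0 S" "z < t + 1" "res p (0, z) = t" for z
    proof -
      have "z < p" using z(2) p by simp
      \<comment> \<open>This case is vacuous: \<open>t\<close> is neither 0 nor in
        \<open>S\<close>.\<close>
      then have "z = t" using z p by (simp add: res_def min_def split: if_splits)
      then show ?thesis using z(1) t wp p by (auto simp: S_def)
    qed
  qed
  have cpart: "sum f (insert (w * p) H) = f (w * p) + sum f H" for f :: "nat \<Rightarrow> 'a::comm_monoid_add"
    using finH tH by simp
  have fin': "finite (insert (w * p) H)" "0 \<notin> insert (w * p) H" using finH nzH w p by auto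
  have "\<exists>b. has_core_weight p (strict_partition (insert (w * p) H)) b"
    using fin' p t by (intro exists_core p_strict_strict_partition) auto
  then obtain b where b: "has_core_weight p (strict_partition (insert (w * p) H)) b" ..
  then have pow: "(remove_pbar p ^^ snd b) (strict_partition (insert (w * p) H)) (fst b)"
    and core: "pbar_core p (fst b)" by (auto simp: has_core_weight_def)
  have "fst b = strict_partition H"
  proof (rule pbar_core_eqI[OF core _ p])
    show "pbar_core p (strict_partition H)" unfolding H_def by (rule pbar_core_half_core[OF p])
    fix j assume j: "1 \<le> j" "j \<le> t"
    then have jp: "0 < j" "j < p" using p by auto
    \<comment> \<open>The part \<open>w * p\<close> lies on runner 0 and carries no charge, so the
      core is unchanged; the weight then follows from the size.\<close>
    have "charge p (strict_partition (insert (w * p) H)) j = charge p (strict_partition H) j"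
      unfolding charge_def sum_list_strict_partition[OF finH] sum_list_strict_partition[OF fin'(1)] cpart
      using jp by (simp add: bead_def)
    then show "charge p (fst b) j = charge p (strict_partition H) j"
      using remove_pbar_power_invariant[OF pow jp] by simp
  qed
  moreover have "snd b = w"
  proof -
    have "sum_list (strict_partition (insert (w * p) H)) = w * p + sum_list (strict_partition H)"
      using sum_list_strict_partition[OF finH, of "\<lambda>x. x"] sum_list_strict_partition[OF fin'(1), of "\<lambda>x. x"]
      by (simp add: cpart[of "\<lambda>x. x"])
    then have "p * snd b = p * w"
      using remove_pbar_power_invariant[OF pow, of 1] p t calculation by (simp add: mult.commute)
    then show ?thesis using p by (simp only: mult_cancel1) simp
  qed
  ultimately have beq: "b = (strict_partition H, w)" by (simp add: prod_eq_iff)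
  have "\<exists>c. has_core_weight p (strict_partition S) c"
    using fin nz p t by (intro exists_core p_strict_strict_partition) auto
  then show ?thesis using edge b unfolding block_edge_def low beq H_def[symmetric] by blast
qed

section \<open>Membership, strict maximality and rank of the vertex block\<close>

theorem theorem5p1:
  fixes p t w :: nat and rho :: "nat list"
  assumes "prime p" and "odd p" and "t = (p - 1) div 2" and "w \<ge> 1"
    and "rho = core_of_tuple p (map (\<lambda>i. (w + (i - 1) * (w - 1), 0)) [1..<Suc t])"
  shows "(rho, w) \<in> non_end_blocks p w
    \<and> (\<forall>b\<in>non_end_blocks p w. b \<noteq> (rho, w) \<longrightarrow> rank p b < rank p (rho, w))
    \<and> real (rank p (rho, w)) =
        real p * real w
        + (real p * (real w - 1) / 2 + 1) * (\<Sum>i=1..t. (real i)^2 * (real w - 1) + real i)"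
proof -
  note w = \<open>w \<ge> 1\<close>
  have p: "p = 2 * t + 1" using assms(2,3) by (auto elim: oddE)
  moreover have "p \<noteq> 1" using assms(1) by auto
  ultimately have t: "1 \<le> t" by simp
  define m where "m = (\<lambda>i. w + (i - 1) * (w - 1))"
  have m: "int (m j) = 1 + int j * (int w - 1)" if "1 \<le> j" for j
  proof -
    have minus: "int (j - 1) = int j - 1" "int (w - 1) = int w - 1" using that w by simp_all
    show ?thesis unfolding m_def of_nat_add of_nat_mult minus by (simp add: algebra_simps)
  qed
  have rho: "rho = strict_partition (half_core t m)"
    using core_of_tuple_half_core[OF p, of m] w assms(5) by (simp add: m_def)
  have core: "pbar_core p rho" unfolding rho by (rule pbar_core_half_core[OF p])
  have charge_rho: "charge p rho j = 1 + int j * (int w - 1)" if "1 \<le> j" "j \<le> t" for j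
    unfolding rho using charge_half_core[OF p that] m that by simp
  have energy_rho: "2 * int (sum_list rho) = energy t (\<lambda>j. 1 + int j * (int w - 1))"
    unfolding pbar_core_energy[OF core p] energy_def by (intro sum.cong) (simp_all add: charge_rho)
  have half: "(p - 1) div 2 = t" using assms(3) by simp
  \<comment> \<open>Lying at no maximal-rank end means having an outgoing \<open>i\<close>-edge for
    every \<open>i\<close>.\<close>
  have non_end: "b \<in> non_end_blocks p w \<longleftrightarrow>
      pbar_core p (fst b) \<and> snd b = w \<and> (\<forall>i\<le>t. \<exists>c. block_edge p i b c)" for b
    unfolding non_end_blocks_def weight_def half mem_Collect_eq atLeast0AtMost
    using at_max_end_iff[OF p t, of b] unfolding is_block_def by blast

  have "(rho, w) \<in> non_end_blocks p w"
  proof -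
    have "\<exists>c. block_edge p i (rho, w) c" if "i \<le> t" for i
    proof (cases "i = t")
      case True
      have "w \<le> m 1" "0 < m t" using w by (simp_all add: m_def)
      then show ?thesis unfolding True rho by (rule edge_from_core_with_part[OF p t w])
    next
      case False
      with that have "i < t" by simp
      from edge_to_core[OF p this core charge_rho w] show ?thesis by simp
    qed
    then show ?thesis unfolding non_end by (simp add: core)
  qed
  moreover have "rank p b < rank p (rho, w)" if b: "b \<in> non_end_blocks p w" "b \<noteq> (rho, w)" for b
  proof -
    define n where "n = charge p (fst b)"
    have b_core: "pbar_core p (fst b)" and b_w: "snd b = w"
      and edges: "\<And>i. i \<le> t \<Longrightarrow> \<exists>c. block_edge p i b c"
      using b(1) by (auto simp: non_end)
    \<comment> \<open>The weight at the other end of the edge is a natural number.\<close>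
    have bound: "(if i = 0 then n 1 else if i = t then 2 - 2 * n t else n (Suc i) - n i + 1) \<le> int w"
      if i: "i \<le> t" for i
    proof -
      obtain c where "block_edge p i b c" using edges[OF i] by blast
      from block_edge_weight[OF this p t i] show ?thesis
        unfolding b_w n_def by linarith
    qed
    have "fst b \<noteq> rho" using b(2) b_w by (auto simp: prod_eq_iff)
    then obtain k where k: "1 \<le> k" "k \<le> t" "n k \<noteq> 1 + int k * (int w - 1)"
      using pbar_core_eqI[OF b_core core p] charge_rho unfolding n_def by metis
    have "energy t n < energy t (\<lambda>j. 1 + int j * (int w - 1))"
    proof (rule energy_less[where n = n and t = t and k = k and w = "int w", OF _ _ _ _ k])
      show "1 \<le> int w" using w by simp
      show "n 1 \<le> int w" using bound[of 0] by simp
      show "n (Suc i) \<le> n i + int w - 1" if "1 \<le> i" "i < t" for i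
        using bound[of i] that by simp
      show "2 - int w \<le> 2 * n t" using bound[of t] t by simp
    qed
    then have "2 * int (sum_list (fst b)) < 2 * int (sum_list rho)"
      using pbar_core_energy[OF b_core p] energy_rho by (simp add: n_def)
    then show ?thesis by (simp add: rank_def b_w)
  qed
  moreover have "real (rank p (rho, w)) = real p * real w
        + (real p * (real w - 1) / 2 + 1) * (\<Sum>i=1..t. (real i)^2 * (real w - 1) + real i)"
  proof -
    \<comment> \<open>At charge \<open>1 + j * (w - 1)\<close> the \<open>j\<close>-th summand
      factors as \<open>(p * (w - 1) + 2) * (j^2 * (w - 1) + j)\<close>.\<close>
    have "energy t (\<lambda>j. 1 + int j * (int w - 1)) =
        (int p * (int w - 1) + 2) * (\<Sum>i=1..t. int i ^ 2 * (int w - 1) + int i)"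
      unfolding energy_def sum_distrib_left
      by (intro sum.cong) (simp_all add: p power2_eq_square algebra_simps)
    then have "2 * int (sum_list rho) =
        (int p * (int w - 1) + 2) * (\<Sum>i=1..t. int i ^ 2 * (int w - 1) + int i)"
      using energy_rho by simp
    from arg_cong[OF this, of real_of_int]
    have "2 * real (sum_list rho) =
        (real p * (real w - 1) + 2) * (\<Sum>i=1..t. (real i)^2 * (real w - 1) + real i)"
      by simp
    moreover have "x = (a / 2 + 1) * s" if "2 * x = (a + 2) * s" for x a s :: real
      using that by (simp add: field_simps)
    ultimately show ?thesis by (simp add: rank_def)
  qed
  ultimately show ?thesis by blast
qed

end
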